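(* Let $p$ be a prime. If $G$ is a powerful $p$-group and $H \leq G$ is a subgroup, then $d(H) \leq d(G)$.
   Context: For a finite group $X$, $d(X)$ denotes the minimal number of generators of $X$. For a positive integer $n$, $G^{n} = \langle g^{n} \mid g \in G\rangle$. A finite $p$-group $G$ is powerful if $[G,G] \leq G^{p}$ in the case that $p$ is odd, and $[G,G] \leq G^{4}$ in the case that $p = 2$. *)

theory Defs
  imports "HOL-Algebra.Algebra"
begin

definition finite_p_group :: "nat \<Rightarrow> ('a, 'b) monoid_scheme \<Rightarrow> bool" where
  "finite_p_group p G \<longleftrightarrow> group G \<and> finite (carrier G) \<and> (\<exists>k. order G = p ^ k)"

(* Meaningful for finite groups, where the set of candidates is nonempty;
   the trivial group has min_gens = 0, generated by the empty set. *)
definition min_gens :: "('a, 'b) monoid_scheme \<Rightarrow> nat" where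
  "min_gens G = (LEAST n. \<exists>S. S \<subseteq> carrier G \<and> finite S \<and> card S = n \<and> generate G S = carrier G)"

(* G^n, the subgroup generated by all n-th powers. *)
definition power_subgroup :: "('a, 'b) monoid_scheme \<Rightarrow> nat \<Rightarrow> 'a set" where
  "power_subgroup G n = generate G ((\<lambda>g. g [^]\<^bsub>G\<^esub> n) ` carrier G)"

definition powerful_p_group :: "nat \<Rightarrow> ('a, 'b) monoid_scheme \<Rightarrow> bool" where
  "powerful_p_group p G \<longleftrightarrow> finite_p_group p G \<and>
     derived G (carrier G) \<subseteq> power_subgroup G (if p = 2 then 4 else p)"

end

theory Submission
  imports Defs
begin

text \<open>
  Write \<open>\<Phi>(X)\<close> for the subgroup generated by the \<open>p\<close>-th powers and the commutators of a finite
  \<open>p\<close>-group \<open>X\<close>. By Burnside's basis theorem \<open>|X : \<Phi>(X)| = p\<^bsup>d(X)\<^esup>\<close> (lemmas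
  \<open>min_gens_le_frattini_index\<close> and \<open>frattini_index_le_min_gens\<close>), so the theorem says that
  \<open>|H : \<Phi>(H)| \<le> |G : \<Phi>(G)|\<close>. In this form it is proved by counting alone, without choosing
  generators, in \<open>powerful_subgroup_frattini_index\<close>.

  The structure behind the count is the following. In a powerful group \<open>G\<close> we have
  \<open>\<Phi>(G) = G\<^sup>p\<close>; this subgroup \<open>P\<close> is again powerful (\<open>powerful_power_subgroup\<close>), and
  \<open>x \<mapsto> x\<^sup>p\<close> induces a homomorphism from \<open>G\<close> onto \<open>P / P\<^sup>p\<close> (\<open>powerful_pth_power_hom\<close>). By
  induction the inequality holds for the subgroup \<open>H \<inter> P\<close> of \<open>P\<close>. Passing from \<open>H \<inter> P\<close> to \<open>H\<close>
  adds generators for the image of \<open>H\<close> in \<open>G / P\<close>. But the \<open>p\<close>-th powers of elements of \<open>H\<close> lie in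
  \<open>\<Phi>(H)\<close>, so they make some generators of \<open>H \<inter> P\<close> superfluous, and the homomorphism controls how
  many.

  Both properties of \<open>P\<close> rest on the inclusion \<open>[P, G] \<subseteq> P\<^sup>p\<close>, with \<open>P\<^sup>4\<close> in place of
  \<open>P\<^sup>p\<close> if \<open>p = 2\<close>. Since a nontrivial normal section of a \<open>p\<close>-group has a nontrivial central
  quotient of exponent \<open>p\<close> (\<open>p_group_chief_step\<close>), it is enough to verify the inclusion where the
  commutators \<open>[x\<^sup>p, g]\<close> are central of exponent \<open>p\<close>, and there it is a short calculation.
\<close>

section \<open>Commutators and the centre of a finite p-group\<close>

definition commutator :: "('a, 'b) monoid_scheme \<Rightarrow> 'a \<Rightarrow> 'a \<Rightarrow> 'a" where
  "commutator G x y = x \<otimes>\<^bsub>G\<^esub> y \<otimes>\<^bsub>G\<^esub> inv\<^bsub>G\<^esub> x \<otimes>\<^bsub>G\<^esub> inv\<^bsub>G\<^esub> y"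

context group begin

lemma commutator_closed [simp, intro]:
  "x \<in> carrier G \<Longrightarrow> y \<in> carrier G \<Longrightarrow> commutator G x y \<in> carrier G"
  by (simp add: commutator_def)

lemma commutator_mult:
  assumes "x \<in> carrier G" "y \<in> carrier G"
  shows "commutator G x y \<otimes> y \<otimes> x = x \<otimes> y"
  using assms by (simp add: commutator_def m_assoc)

lemma commutator_conj:
  assumes "x \<in> carrier G" "y \<in> carrier G"
  shows "x \<otimes> y \<otimes> inv x = commutator G x y \<otimes> y"
  using assms by (simp add: commutator_def m_assoc)

lemma commutator_inv:
  assumes "x \<in> carrier G" "y \<in> carrier G"
  shows "inv (commutator G x y) = commutator G y x"
  using assms by (simp add: commutator_def m_assoc inv_mult_group)

lemma commutator_eq_one_iff:
  assumes "x \<in> carrier G" "y \<in> carrier G"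
  shows "commutator G x y = \<one> \<longleftrightarrow> x \<otimes> y = y \<otimes> x"
proof
  assume "commutator G x y = \<one>"
  with commutator_mult[OF assms] show "x \<otimes> y = y \<otimes> x" using assms by simp
next
  assume "x \<otimes> y = y \<otimes> x"
  hence "commutator G x y \<otimes> (y \<otimes> x) = y \<otimes> x"
    using commutator_mult[OF assms] assms by (simp add: m_assoc)
  thus "commutator G x y = \<one>"
    using assms by (metis commutator_closed l_cancel_one' m_closed r_cancel_one)
qed

lemma derived_set_eq: "derived_set G H = {commutator G x y | x y. x \<in> H \<and> y \<in> H}"
  by (auto simp: commutator_def)

lemma subgroup_nat_pow_closed:
  assumes "subgroup H G" "h \<in> H"
  shows "h [^] (k::nat) \<in> H"
  by (induction k) (use assms in \<open>auto intro: subgroup.one_closed subgroup.m_closed\<close>)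

lemma finite_closed_imp_subgroup:
  assumes "finite (carrier G)" "S \<subseteq> carrier G" "\<one> \<in> S"
    and closed: "\<And>x y. x \<in> S \<Longrightarrow> y \<in> S \<Longrightarrow> x \<otimes> y \<in> S"
  shows "subgroup S G"
proof (rule subgroupI)
  show "S \<subseteq> carrier G" "S \<noteq> {}" "\<And>x y. x \<in> S \<Longrightarrow> y \<in> S \<Longrightarrow> x \<otimes> y \<in> S"
    using assms by auto
  fix x assume x: "x \<in> S"
  have pow: "x [^] n \<in> S" for n :: nat
    by (induction n) (use x assms in auto)
  have "order G > 0" using assms(1) by (simp add: order_gt_0_iff_finite)
  then obtain n where n: "order G = Suc n" using gr0_implies_Suc by blast
  have "x [^] n \<otimes> x = \<one>"
    using pow_order_eq_1[of x] x assms(2) n by (metis nat_pow_Suc subsetD)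
  hence "inv x = x [^] n"
    using x assms(2) by (metis inv_equality nat_pow_closed subsetD)
  thus "inv x \<in> S" using pow by simp
qed

end

lemma (in group_hom) hom_commutator:
  "x \<in> carrier G \<Longrightarrow> y \<in> carrier G \<Longrightarrow> h (commutator G x y) = commutator H (h x) (h y)"
  by (simp add: commutator_def)

lemma (in normal) rcos_eq_iff:
  assumes "x \<in> carrier G"
  shows "H #> x = H \<longleftrightarrow> x \<in> H"
  using assms by (metis coset_join1 rcos_const subgroup_axioms subset is_group)

lemma (in normal) group_hom_rcos: "group_hom G (G Mod H) ((#>) H)"
  by (simp add: group_hom_def group_hom_axioms_def is_group factorgroup_is_group r_coset_hom_Mod)

lemma p_power_dvd_cases:
  fixes p :: nat
  assumes "Factorial_Ring.prime p" "m dvd p ^ k"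
  shows "m = 1 \<or> p dvd m"
proof -
  obtain i where "i \<le> k" "m = p ^ i" using assms divides_primepow_nat by blast
  thus ?thesis by (cases i) auto
qed

lemma finite_p_group_subgroup:
  fixes G (structure)
  assumes "Factorial_Ring.prime p" "finite_p_group p G" "subgroup H G"
  shows "finite_p_group p (G\<lparr>carrier := H\<rparr>)"
proof -
  interpret group G using assms(2) by (simp add: finite_p_group_def)
  obtain k where k: "order G = p ^ k" using assms(2) by (auto simp: finite_p_group_def)
  have "card (rcosets H) * card H = order G" by (rule lagrange[OF assms(3)])
  hence "card H dvd p ^ k" using k by (metis dvd_triv_right)
  then obtain i where "card H = p ^ i" using assms(1) divides_primepow_nat by blast
  moreover have "finite H"
    using assms(2,3) by (meson finite_p_group_def finite_subset subgroup.subset)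
  ultimately show ?thesis
    using assms(3) by (auto simp: finite_p_group_def order_def subgroup_imp_group)
qed

lemma finite_p_group_factor:
  fixes G (structure)
  assumes "Factorial_Ring.prime p" "finite_p_group p G" "H \<lhd> G"
  shows "finite_p_group p (G Mod H)"
proof -
  interpret normal H G by (rule assms(3))
  obtain k where k: "order G = p ^ k" and fin: "finite (carrier G)"
    using assms(2) by (auto simp: finite_p_group_def)
  have "card (rcosets H) * card H = order G" by (rule lagrange[OF subgroup_axioms])
  hence "card (rcosets H) dvd p ^ k" using k by (metis dvd_triv_left)
  then obtain i where "card (rcosets H) = p ^ i" using assms(1) divides_primepow_nat by blast
  moreover have "finite (rcosets H)" using fin by (simp add: RCOSETS_def)
  ultimately show ?thesis
    using factorgroup_is_group by (auto simp: finite_p_group_def order_def FactGroup_def)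
qed

text \<open>
  The class equation: every conjugacy class has size a power of \<open>p\<close>, and the sizes add up to a
  multiple of \<open>p\<close>, so \<open>\<one>\<close> cannot be the only class of size one.
\<close>

lemma p_group_center_nontrivial:
  fixes G (structure)
  assumes p: "Factorial_Ring.prime p" and G: "finite_p_group p G" and nt: "order G \<noteq> 1"
  shows "\<exists>z\<in>carrier G. z \<noteq> \<one> \<and> z [^] p = \<one> \<and>
           (\<forall>g\<in>carrier G. z \<otimes> g = g \<otimes> z)"
proof -
  interpret group G using G by (simp add: finite_p_group_def)
  obtain k where k: "order G = p ^ k" and fin: "finite (carrier G)"
    using G by (auto simp: finite_p_group_def)
  define \<phi> where "\<phi> = (\<lambda>g. (\<lambda>h \<in> carrier G. g \<otimes> h \<otimes> (inv g)))"
  interpret A: group_action G "carrier G" \<phi>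
    unfolding \<phi>_def by (rule action_by_conjugation)
  have orb_one: "orbit G \<phi> \<one> = {\<one>}"
    unfolding orbit_def \<phi>_def by (auto intro!: exI[of _ \<one>])
  have orb1: "\<exists>z\<in>carrier G. z \<noteq> \<one> \<and> card (orbit G \<phi> z) = 1"
  proof (rule ccontr)
    assume *: "\<not> ?thesis"
    have dvd: "p dvd card ob" if "ob \<in> orbits G (carrier G) \<phi> - {{\<one>}}" for ob
    proof -
      from that obtain x where x: "x \<in> carrier G" "ob = orbit G \<phi> x" by (auto simp: orbits_def)
      have "x \<noteq> \<one>" using that x orb_one by auto
      hence "card ob \<noteq> 1" using * x by auto
      moreover have "card ob dvd p ^ k"
        using A.orbit_stabilizer_theorem[OF x(1)] k x by (metis dvd_triv_left)
      ultimately show ?thesis using p_power_dvd_cases p by blast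
    qed
    have finO: "finite (orbits G (carrier G) \<phi>)"
      using fin by (auto simp: orbits_def)
    have mem: "{\<one>} \<in> orbits G (carrier G) \<phi>" using orb_one by (auto simp: orbits_def)
    have "p ^ k = (\<Sum>orb\<in>orbits G (carrier G) \<phi>. card orb)"
      using A.disjoint_sum[OF fin, of "\<lambda>_. 1::nat"] k by (simp add: order_def)
    also have "\<dots> = 1 + (\<Sum>orb\<in>orbits G (carrier G) \<phi> - {{\<one>}}. card orb)"
      using sum.remove[OF finO mem, of card] by simp
    finally have eq: "p ^ k = 1 + (\<Sum>orb\<in>orbits G (carrier G) \<phi> - {{\<one>}}. card orb)" .
    have "p dvd (\<Sum>orb\<in>orbits G (carrier G) \<phi> - {{\<one>}}. card orb)"
      by (rule dvd_sum) (use dvd in auto)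
    moreover have "p dvd p ^ k" using nt k by (cases k) auto
    ultimately have "p dvd 1" using eq by (metis dvd_add_left_iff)
    thus False using p by (simp add: prime_nat_iff)
  qed
  then obtain z where z: "z \<in> carrier G" "z \<noteq> \<one>" "card (orbit G \<phi> z) = 1" by blast
  have central: "z \<otimes> g = g \<otimes> z" if g: "g \<in> carrier G" for g
  proof -
    have "z \<in> orbit G \<phi> z" using z by (simp add: A.orbit_refl)
    moreover have "g \<otimes> z \<otimes> inv g \<in> orbit G \<phi> z"
      using g z by (auto simp: orbit_def \<phi>_def)
    ultimately have "g \<otimes> z \<otimes> inv g = z" using z(3) by (metis card_1_singletonE singletonD)
    thus ?thesis using g z by (metis inv_closed inv_solve_right m_closed)
  qed
  \<comment> \<open>A suitable power of the central element has order exactly \<open>p\<close>.\<close>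
  define i where "i = (LEAST i. z [^] (p ^ i) = \<one>)"
  have ex: "z [^] (p ^ k) = \<one>" using z k pow_order_eq_1 by metis
  have i: "z [^] (p ^ i) = \<one>" unfolding i_def by (rule LeastI[where k=k]) (rule ex)
  have "i \<noteq> 0" using i z by (cases "i = 0") auto
  then obtain j where j: "i = Suc j" using not0_implies_Suc by blast
  have "z [^] (p ^ j) \<noteq> \<one>"
    using not_less_Least[of j "\<lambda>i. z [^] (p ^ i) = \<one>"] j i_def by auto
  moreover have "(z [^] (p ^ j)) [^] p = \<one>"
    using i j z by (simp add: nat_pow_pow mult.commute)
  moreover have "z [^] (p ^ j) \<otimes> g = g \<otimes> z [^] (p ^ j)" if "g \<in> carrier G" for g
    using group_commutes_pow[OF central[OF that] z(1) that] by simp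
  ultimately show ?thesis using z by blast
qed

section \<open>Frattini subgroup and number of generators\<close>

lemma finite_family_has_maximal:
  fixes \<F> :: "'a set set"
  assumes "finite \<F>" "a \<in> \<F>"
  obtains m where "m \<in> \<F>" "\<forall>K\<in>\<F>. m \<subseteq> K \<longrightarrow> m = K"
proof -
  have "\<F> \<noteq> {}" using assms(2) by blast
  from finite_has_maximal[OF assms(1) this] show thesis using that by blast
qed

text \<open>
  This is the only form in which the nilpotency of \<open>p\<close>-groups enters. Take for \<open>K\<close> the preimage of
  the subgroup of elements of exponent \<open>p\<close> in the centre of \<open>G / J\<close>; it is larger than \<open>J\<close> since
  the centre of a nontrivial \<open>p\<close>-group is nontrivial.
\<close>

lemma p_group_normal_step:
  fixes G (structure)
  assumes p: "Factorial_Ring.prime p" and G: "finite_p_group p G"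
    and J: "J \<lhd> G" and proper: "J \<noteq> carrier G"
  obtains K where "K \<lhd> G" "J \<subset> K" "\<forall>k\<in>K. k [^] p \<in> J"
    "\<forall>k\<in>K. \<forall>g\<in>carrier G. commutator G k g \<in> J"
proof -
  interpret normal J G by (rule J)
  interpret \<pi>: group_hom G "G Mod J" "(#>) J" by (rule group_hom_rcos)
  have fin: "finite (carrier G)" using G by (simp add: finite_p_group_def)
  have surj: "carrier (G Mod J) = (#>) J ` carrier G" by (rule carrier_FactGroup)
  have one: "J #> x = \<one>\<^bsub>G Mod J\<^esub> \<longleftrightarrow> x \<in> J" if "x \<in> carrier G" for x
    using that rcos_eq_iff by simp
  define K where "K = {k \<in> carrier G. k [^] p \<in> J \<and> (\<forall>g\<in>carrier G. commutator G k g \<in> J)}"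
  have pow_iff: "k [^] p \<in> J \<longleftrightarrow> (J #> k) [^]\<^bsub>G Mod J\<^esub> p = \<one>\<^bsub>G Mod J\<^esub>" if "k \<in> carrier G" for k
    using that one[of "k [^] p"] \<pi>.hom_nat_pow[of k p] by simp
  have comm_iff: "commutator G k g \<in> J \<longleftrightarrow>
      (J #> k) \<otimes>\<^bsub>G Mod J\<^esub> (J #> g) = (J #> g) \<otimes>\<^bsub>G Mod J\<^esub> (J #> k)"
    if "k \<in> carrier G" "g \<in> carrier G" for k g
    using that one[of "commutator G k g"] \<pi>.hom_commutator[of k g]
      \<pi>.H.commutator_eq_one_iff[OF \<pi>.hom_closed \<pi>.hom_closed, of k g] by simp
  have K_iff: "k \<in> K \<longleftrightarrow> k \<in> carrier G \<and> (J #> k) [^]\<^bsub>G Mod J\<^esub> p = \<one>\<^bsub>G Mod J\<^esub> \<and>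
      (\<forall>y\<in>carrier (G Mod J). (J #> k) \<otimes>\<^bsub>G Mod J\<^esub> y = y \<otimes>\<^bsub>G Mod J\<^esub> (J #> k))" for k
    unfolding K_def surj using pow_iff comm_iff by auto
  have JK: "J \<subseteq> K"
  proof
    fix j assume j: "j \<in> J"
    hence "J #> j = \<one>\<^bsub>G Mod J\<^esub>" using one by simp
    thus "j \<in> K" unfolding K_iff using j \<pi>.H.nat_pow_one \<pi>.H.l_one \<pi>.H.r_one by (metis mem_carrier)
  qed
  have "subgroup K G"
  proof (rule finite_closed_imp_subgroup[OF fin])
    show "K \<subseteq> carrier G" by (auto simp: K_def)
    show "\<one> \<in> K" using JK by auto
    fix a b assume ab: "a \<in> K" "b \<in> K"
    define a' b' where "a' = J #> a" and "b' = J #> b"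
    have a: "a \<in> carrier G" and b: "b \<in> carrier G" using ab by (auto simp: K_def)
    have cl: "a' \<in> carrier (G Mod J)" "b' \<in> carrier (G Mod J)"
      unfolding a'_def b'_def using a b by (auto intro: \<pi>.hom_closed)
    have ab': "J #> (a \<otimes> b) = a' \<otimes>\<^bsub>G Mod J\<^esub> b'"
      unfolding a'_def b'_def using a b by (rule \<pi>.hom_mult)
    have ca: "a' \<otimes>\<^bsub>G Mod J\<^esub> y = y \<otimes>\<^bsub>G Mod J\<^esub> a'"
      and cb: "b' \<otimes>\<^bsub>G Mod J\<^esub> y = y \<otimes>\<^bsub>G Mod J\<^esub> b'" if "y \<in> carrier (G Mod J)" for y
      unfolding a'_def b'_def using ab that K_iff by blast+
    have "(a' \<otimes>\<^bsub>G Mod J\<^esub> b') [^]\<^bsub>G Mod J\<^esub> p = \<one>\<^bsub>G Mod J\<^esub>"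
      using \<pi>.H.pow_mult_distrib[OF ca[OF cl(2)] cl, of p] ab K_iff \<pi>.H.r_one \<pi>.H.one_closed
      unfolding a'_def b'_def by metis
    moreover have "(a' \<otimes>\<^bsub>G Mod J\<^esub> b') \<otimes>\<^bsub>G Mod J\<^esub> y = y \<otimes>\<^bsub>G Mod J\<^esub> (a' \<otimes>\<^bsub>G Mod J\<^esub> b')"
      if y: "y \<in> carrier (G Mod J)" for y
      using ca[OF y] cb[OF y] cl y \<pi>.H.m_assoc by metis
    ultimately show "a \<otimes> b \<in> K" unfolding K_iff ab' using a b by blast
  qed
  hence "K \<lhd> G"
    unfolding normal_inv_iff
  proof (intro conjI ballI)
    fix x k assume x: "x \<in> carrier G" and k: "k \<in> K"
    have kc: "k \<in> carrier G" using k by (simp add: K_def)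
    have "commutator G x k \<in> J"
      using k x commutator_inv[OF kc x] by (metis (no_types, lifting) K_def m_inv_closed mem_Collect_eq)
    thus "x \<otimes> k \<otimes> inv x \<in> K"
      using commutator_conj[OF x kc] JK k \<open>subgroup K G\<close> by (metis subgroup.m_closed subsetD)
  qed
  have "\<exists>k\<in>K. k \<notin> J"
  proof -
    have "order (G Mod J) \<noteq> 1"
    proof
      assume "order (G Mod J) = 1"
      hence "carrier (G Mod J) = {\<one>\<^bsub>G Mod J\<^esub>}" using \<pi>.H.order_one_triv_iff by blast
      hence "J #> x = \<one>\<^bsub>G Mod J\<^esub>" if "x \<in> carrier G" for x
        using \<pi>.hom_closed[OF that] by auto
      thus False using one proper subset by blast
    qed
    from p_group_center_nontrivial[OF p finite_p_group_factor[OF p G J] this]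
    obtain z where z: "z \<in> carrier (G Mod J)" "z \<noteq> \<one>\<^bsub>G Mod J\<^esub>" "z [^]\<^bsub>G Mod J\<^esub> p = \<one>\<^bsub>G Mod J\<^esub>"
      "\<forall>y\<in>carrier (G Mod J). z \<otimes>\<^bsub>G Mod J\<^esub> y = y \<otimes>\<^bsub>G Mod J\<^esub> z" by blast
    then obtain k where "k \<in> carrier G" "z = J #> k" unfolding surj by blast
    thus ?thesis using z K_iff one by blast
  qed
  hence "J \<subset> K" using JK by blast
  show thesis
  proof (rule that[OF \<open>K \<lhd> G\<close> \<open>J \<subset> K\<close>])
    show "\<forall>k\<in>K. k [^] p \<in> J" by (simp add: K_def)
    show "\<forall>k\<in>K. \<forall>g\<in>carrier G. commutator G k g \<in> J" by (simp add: K_def)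
  qed
qed

text \<open>
  To show \<open>T \<subseteq> B\<close> in a \<open>p\<close>-group, one may argue by contradiction in a quotient \<open>G / J\<close> with
  \<open>B \<subseteq> J\<close> in which the image of \<open>T\<close> is not trivial, but consists of central elements of exponent
  \<open>p\<close>: if \<open>J\<close> is maximal among the normal subgroups that contain \<open>B\<close> but not \<open>T\<close>, then the group
  \<open>K\<close> of the previous lemma must contain \<open>T\<close>.
\<close>

lemma p_group_chief_step:
  fixes G (structure)
  assumes p: "Factorial_Ring.prime p" and G: "finite_p_group p G"
    and B: "B \<lhd> G" and T: "T \<subseteq> carrier G" "\<not> T \<subseteq> B"
  obtains J where "J \<lhd> G" "B \<subseteq> J" "\<not> T \<subseteq> J" "\<forall>t\<in>T. t [^] p \<in> J"
    "\<forall>t\<in>T. \<forall>g\<in>carrier G. commutator G t g \<in> J"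
proof -
  let ?X = "{J. J \<lhd> G \<and> B \<subseteq> J \<and> \<not> T \<subseteq> J}"
  have "finite (Pow (carrier G))" using G by (simp add: finite_p_group_def)
  moreover have "?X \<subseteq> Pow (carrier G)"
    using normal_imp_subgroup subgroup.subset by blast
  ultimately have fin: "finite ?X" by (rule rev_finite_subset)
  have mem: "B \<in> ?X" using B T by simp
  obtain J where J: "J \<in> ?X" and max [rule_format]: "\<forall>K\<in>?X. J \<subseteq> K \<longrightarrow> J = K"
    using finite_family_has_maximal[OF fin mem] .
  have JN: "J \<lhd> G" and JG: "J \<noteq> carrier G" using J T by auto
  obtain K where K [rule_format]: "K \<lhd> G" "J \<subset> K" "\<forall>k\<in>K. k [^] p \<in> J"
    "\<forall>k\<in>K. \<forall>g\<in>carrier G. commutator G k g \<in> J"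
    using p_group_normal_step[OF p G JN JG] .
  have "T \<subseteq> K" using max[of K] K J by blast
  thus thesis using that[of J] J K by blast
qed

text \<open>
  For a finite \<open>p\<close>-group this is the Frattini subgroup, the intersection of the maximal subgroups.
  Unlike that intersection, it is visibly monotone in the group.
\<close>

definition frattini :: "nat \<Rightarrow> ('a, 'b) monoid_scheme \<Rightarrow> 'a set" where
  "frattini p G = generate G ((\<lambda>x. x [^]\<^bsub>G\<^esub> p) ` carrier G \<union> derived_set G (carrier G))"

lemma (in group) frattini_gens_incl:
  "(\<lambda>x. x [^] (p::nat)) ` carrier G \<union> derived_set G (carrier G) \<subseteq> carrier G"
  using derived_set_in_carrier[of "carrier G"] by auto

lemma (in group) frattini_subgroup: "subgroup (frattini p G) G"
  unfolding frattini_def by (rule generate_is_subgroup[OF frattini_gens_incl])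

lemma (in group) pow_in_frattini: "x \<in> carrier G \<Longrightarrow> x [^] p \<in> frattini p G"
  unfolding frattini_def by (rule generate.incl) auto

lemma (in group) commutator_in_frattini:
  "x \<in> carrier G \<Longrightarrow> y \<in> carrier G \<Longrightarrow> commutator G x y \<in> frattini p G"
  unfolding frattini_def derived_set_eq by (rule generate.incl) auto

text \<open>
  The reason is that a maximal subgroup \<open>M\<close> is normal with quotient of exponent \<open>p\<close> and abelian.
  To see this, let \<open>J\<close> be the largest normal subgroup inside \<open>M\<close> and \<open>K\<close> the subgroup above \<open>J\<close>
  that is central of exponent \<open>p\<close> modulo \<open>J\<close>. Then \<open>K\<close> is not contained in \<open>M\<close>, so
  \<open>K M = G\<close>. Conjugation by \<open>K\<close> changes elements of \<open>M\<close> only by factors from \<open>J \<subseteq> M\<close>,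
  whence \<open>M\<close> is normal, and every coset of \<open>M\<close> has a representative in \<open>K\<close>.
\<close>

lemma p_group_maximal_above_frattini:
  fixes G (structure)
  assumes p: "Factorial_Ring.prime p" and G: "finite_p_group p G"
    and M0: "subgroup M0 G" "M0 \<noteq> carrier G"
  obtains M where "subgroup M G" "M \<noteq> carrier G" "M0 \<subseteq> M" "frattini p G \<subseteq> M"
proof -
  interpret group G using G by (simp add: finite_p_group_def)
  have finP: "finite (Pow (carrier G))" using G by (simp add: finite_p_group_def)
  let ?X = "{M. subgroup M G \<and> M0 \<subseteq> M \<and> M \<noteq> carrier G}"
  have fin: "finite ?X" by (rule rev_finite_subset[OF finP]) (use subgroup.subset in blast)
  have mem: "M0 \<in> ?X" using M0 by simp
  obtain M where M: "M \<in> ?X" and M_max [rule_format]: "\<forall>K\<in>?X. M \<subseteq> K \<longrightarrow> M = K"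
    using finite_family_has_maximal[OF fin mem] .
  have sM: "subgroup M G" using M by simp
  let ?Y = "{J. J \<lhd> G \<and> J \<subseteq> M}"
  have fin: "finite ?Y"
    by (rule rev_finite_subset[OF finP]) (use normal_imp_subgroup subgroup.subset in blast)
  have mem: "{\<one>} \<in> ?Y" using one_is_normal sM by (simp add: subgroup.one_closed)
  obtain J where J: "J \<in> ?Y" and J_max [rule_format]: "\<forall>K\<in>?Y. J \<subseteq> K \<longrightarrow> J = K"
    using finite_family_has_maximal[OF fin mem] .
  have JN: "J \<lhd> G" and JG: "J \<noteq> carrier G" using J M subgroup.subset[OF sM] by auto
  obtain K where K [rule_format]: "K \<lhd> G" "J \<subset> K" "\<forall>k\<in>K. k [^] p \<in> J"
    "\<forall>k\<in>K. \<forall>g\<in>carrier G. commutator G k g \<in> J"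
    using p_group_normal_step[OF p G JN JG] .
  have sK: "subgroup K G" using K(1) by (rule normal_imp_subgroup)
  have Kc: "k \<in> carrier G" if "k \<in> K" for k using sK that by (rule subgroup.mem_carrier)
  have Mc: "m \<in> carrier G" if "m \<in> M" for m using sM that by (rule subgroup.mem_carrier)
  \<comment> \<open>Otherwise \<open>K\<close> would be a normal subgroup inside \<open>M\<close> larger than \<open>J\<close>.\<close>
  have "\<not> K \<subseteq> M" using J_max[of K] K J by blast
  have "subgroup (K <#> M) G" by (rule mult_norm_subgroup[OF K(1) sM])
  moreover have sub: "M \<subseteq> K <#> M" "K \<subseteq> K <#> M"
    unfolding set_mult_def using subgroup.one_closed[OF sK] subgroup.one_closed[OF sM] Kc Mc
    by force+
  ultimately have KM: "K <#> M = carrier G"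
    using M_max[of "K <#> M"] \<open>\<not> K \<subseteq> M\<close> M by blast
  have decomp: "\<exists>k\<in>K. \<exists>m\<in>M. x = k \<otimes> m" if "x \<in> carrier G" for x
    using that unfolding KM[symmetric] set_mult_def by blast
  have "M \<lhd> G" unfolding normal_inv_iff
  proof (intro conjI ballI)
    fix x m' assume x: "x \<in> carrier G" and m': "m' \<in> M"
    obtain k m where km: "k \<in> K" "m \<in> M" "x = k \<otimes> m" using decomp[OF x] by blast
    define n where "n = m \<otimes> m' \<otimes> inv m"
    have n: "n \<in> M" unfolding n_def using km m' sM by (meson subgroup.m_closed subgroup.m_inv_closed)
    have "x \<otimes> m' \<otimes> inv x = k \<otimes> n \<otimes> inv k"
      using km m' Kc Mc by (simp add: n_def inv_mult_group m_assoc)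
    also have "\<dots> = commutator G k n \<otimes> n" using km n Kc Mc by (simp add: commutator_conj)
    also have "\<dots> \<in> M" using K(4)[OF km(1) Mc[OF n]] J n sM by (auto intro: subgroup.m_closed)
    finally show "x \<otimes> m' \<otimes> inv x \<in> M" .
  qed (rule sM)
  then interpret N: normal M G .
  interpret \<pi>: group_hom G "G Mod M" "(#>) M" by (rule N.group_hom_rcos)
  have one: "M #> x = \<one>\<^bsub>G Mod M\<^esub> \<longleftrightarrow> x \<in> M" if "x \<in> carrier G" for x
    using that N.rcos_eq_iff by simp
  have rep: "\<exists>k\<in>K. M #> x = M #> k" if x: "x \<in> carrier G" for x
  proof -
    obtain k m where km: "k \<in> K" "m \<in> M" "x = k \<otimes> m" using decomp[OF x] by blast
    have "M #> x = (M #> k) \<otimes>\<^bsub>G Mod M\<^esub> \<one>\<^bsub>G Mod M\<^esub>"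
      using km Kc Mc one[of m] \<pi>.hom_mult[of k m] by simp
    thus ?thesis using km \<pi>.H.r_one[OF \<pi>.hom_closed] Kc by metis
  qed
  have "x [^] p \<in> M" if x: "x \<in> carrier G" for x
  proof -
    obtain k where k: "k \<in> K" "M #> x = M #> k" using rep[OF x] by blast
    have "M #> (x [^] p) = M #> (k [^] p)"
      using \<pi>.hom_nat_pow[OF x, of p] \<pi>.hom_nat_pow[OF Kc[OF k(1)], of p] k by simp
    moreover have "k [^] p \<in> M" using K(3)[OF k(1)] J by blast
    ultimately show ?thesis using one x k Kc by (metis nat_pow_closed)
  qed
  moreover have "commutator G x y \<in> M" if x: "x \<in> carrier G" and y: "y \<in> carrier G" for x y
  proof -
    obtain k where k: "k \<in> K" "M #> x = M #> k" using rep[OF x] by blast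
    obtain l where l: "l \<in> K" "M #> y = M #> l" using rep[OF y] by blast
    have "M #> commutator G x y = M #> commutator G k l"
      using \<pi>.hom_commutator x y k l Kc by simp
    moreover have "commutator G k l \<in> M" using K(4) k l Kc J by blast
    ultimately show ?thesis using one x y k l Kc by (metis commutator_closed)
  qed
  ultimately have "frattini p G \<subseteq> M"
    unfolding frattini_def derived_set_eq by (intro generate_subgroup_incl[OF _ sM]) auto
  moreover have "M \<noteq> carrier G" "M0 \<subseteq> M" using M by simp_all
  ultimately show thesis using that sM by blast
qed

lemma frattini_nongenerators:
  fixes G (structure)
  assumes p: "Factorial_Ring.prime p" and G: "finite_p_group p G"
    and S: "S \<subseteq> carrier G" and gen: "generate G (S \<union> frattini p G) = carrier G"
  shows "generate G S = carrier G"
proof (rule ccontr)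
  interpret group G using G by (simp add: finite_p_group_def)
  assume *: "generate G S \<noteq> carrier G"
  obtain M where M: "subgroup M G" "M \<noteq> carrier G" "generate G S \<subseteq> M" "frattini p G \<subseteq> M"
    using p_group_maximal_above_frattini[OF p G generate_is_subgroup[OF S] *] .
  have "S \<union> frattini p G \<subseteq> M" using M generate.incl[of _ S G] by blast
  hence "carrier G \<subseteq> M" using generate_subgroup_incl[OF _ M(1)] gen by metis
  thus False using M subgroup.subset by blast
qed

lemma p_group_card_proper_subgroup:
  fixes G (structure)
  assumes p: "Factorial_Ring.prime p" and G: "finite_p_group p G"
    and "subgroup L G" "subgroup L' G" "L \<subset> L'"
  shows "p * card L \<le> card L'"
proof -
  obtain a b where ab: "card L = p ^ a" "card L' = p ^ b"
    using finite_p_group_subgroup[OF p G assms(3)] finite_p_group_subgroup[OF p G assms(4)]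
    by (auto simp: finite_p_group_def order_def)
  have "finite L'" using G assms(4) by (meson finite_p_group_def finite_subset subgroup.subset)
  hence "p ^ a < p ^ b" using psubset_card_mono assms(5) ab by metis
  hence "Suc a \<le> b" using p by (metis Suc_leI power_less_imp_less_exp prime_gt_1_nat)
  hence "p ^ Suc a \<le> p ^ b" by (rule power_increasing) (use prime_ge_1_nat[OF p] in simp)
  thus ?thesis using ab by simp
qed

text \<open>
  One half of Burnside's basis theorem. Adding elements to \<open>S\<close> greedily, as long as
  \<open>\<langle>S, \<Phi>\<rangle>\<close> is proper, multiplies the order of that subgroup by at least \<open>p\<close> in each step; and once
  it is everything, \<open>S\<close> alone generates the group.
\<close>

lemma min_gens_le_frattini_index:
  fixes G (structure)
  assumes p: "Factorial_Ring.prime p" and G: "finite_p_group p G"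
  shows "p ^ min_gens G * card (frattini p G) \<le> order G"
proof -
  interpret group G using G by (simp add: finite_p_group_def)
  have fin: "finite (carrier G)" using G by (simp add: finite_p_group_def)
  define \<Phi> where "\<Phi> = frattini p G"
  have \<Phi>: "subgroup \<Phi> G" "\<Phi> \<subseteq> carrier G"
    unfolding \<Phi>_def using frattini_subgroup subgroup.subset by auto
  let ?L = "\<lambda>S. generate G (S \<union> \<Phi>)"
  let ?X = "{S. S \<subseteq> carrier G \<and> p ^ card S * card \<Phi> \<le> card (?L S)}"
  have finX: "finite ?X" by (rule rev_finite_subset[of "Pow (carrier G)"]) (use fin in auto)
  have mem: "{} \<in> ?X"
    using generateI[OF \<Phi>(1), of \<Phi>] by auto
  obtain S where S: "S \<in> ?X" and max [rule_format]: "\<forall>T\<in>?X. S \<subseteq> T \<longrightarrow> S = T"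
    using finite_family_has_maximal[OF finX mem] .
  have Sc: "S \<subseteq> carrier G" and Sle: "p ^ card S * card \<Phi> \<le> card (?L S)" using S by auto
  have subL: "subgroup (?L T) G" if "T \<subseteq> carrier G" for T
    using that \<Phi> by (intro generate_is_subgroup) auto
  have "?L S = carrier G"
  proof (rule ccontr)
    assume "?L S \<noteq> carrier G"
    then obtain x where x: "x \<in> carrier G" "x \<notin> ?L S"
      using subgroup.subset[OF subL[OF Sc]] by blast
    have xS: "x \<notin> S" using x generate.incl[of x "S \<union> \<Phi>" G] by blast
    have "?L S \<subset> ?L (insert x S)"
      using mono_generate[of "S \<union> \<Phi>" "insert x S \<union> \<Phi>"] x generate.incl[of x "insert x S \<union> \<Phi>" G]
      by blast
    hence "p * card (?L S) \<le> card (?L (insert x S))"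
      by (intro p_group_card_proper_subgroup[OF p G] subL) (use Sc x in auto)
    moreover have "p * (p ^ card S * card \<Phi>) \<le> p * card (?L S)"
      using Sle by (rule mult_le_mono2)
    ultimately have "p * (p ^ card S * card \<Phi>) \<le> card (?L (insert x S))"
      by (rule le_trans[rotated])
    hence "insert x S \<in> ?X"
      using Sc x xS finite_subset[OF Sc fin] by (simp add: mult.assoc)
    thus False using max[of "insert x S"] xS by blast
  qed
  moreover from this have "generate G S = carrier G"
    using frattini_nongenerators[OF p G Sc] by (simp add: \<Phi>_def)
  hence "min_gens G \<le> card S"
    unfolding min_gens_def by (intro Least_le exI[of _ S]) (use Sc fin finite_subset in auto)
  hence "p ^ min_gens G \<le> p ^ card S"
    by (rule power_increasing) (use prime_ge_1_nat[OF p] in simp)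
  ultimately show ?thesis using Sle unfolding order_def \<Phi>_def
    by (metis le_trans mult_le_mono1)
qed

text \<open>
  Modulo \<open>\<Phi>\<close> the group is elementary abelian, so each new generator contributes at most \<open>p\<close> cosets.
\<close>

lemma card_generate_frattini_le:
  fixes G (structure)
  assumes p: "Factorial_Ring.prime p" and G: "finite_p_group p G"
    and "finite S" "S \<subseteq> carrier G"
  shows "card (generate G (S \<union> frattini p G)) \<le> p ^ card S * card (frattini p G)"
  using assms(3,4)
proof (induction S)
  case empty
  interpret group G using G by (simp add: finite_p_group_def)
  have "frattini p G = generate G (frattini p G)" by (rule generateI[OF frattini_subgroup]) auto
  thus ?case by simp
next
  case (insert x S)
  interpret group G using G by (simp add: finite_p_group_def)
  have fin: "finite (carrier G)" using G by (simp add: finite_p_group_def)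
  have p0: "p > 0" using p prime_gt_0_nat by blast
  define L where "L = generate G (S \<union> frattini p G)"
  have x: "x \<in> carrier G" using insert by simp
  have sL: "subgroup L G"
    unfolding L_def using insert subgroup.subset[OF frattini_subgroup[of p]]
    by (intro generate_is_subgroup) auto
  have gL: "S \<subseteq> L" "frattini p G \<subseteq> L" unfolding L_def by (auto intro: generate.incl)
  have Lc: "l \<in> carrier G" if "l \<in> L" for l using sL that by (rule subgroup.mem_carrier)
  \<comment> \<open>The union of the cosets of \<open>L\<close> by powers of \<open>x\<close>; exponents below \<open>p\<close> suffice as \<open>x\<^sup>p \<in> L\<close>.\<close>
  define U where "U = (\<lambda>(l, i). l \<otimes> x [^] (i::nat)) ` (L \<times> {..<p})"
  have U: "l \<otimes> x [^] n \<in> U" if l: "l \<in> L" for l and n :: nat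
  proof -
    have "x [^] p \<in> L" using pow_in_frattini[OF x] gL by blast
    hence "(x [^] p) [^] (n div p) \<in> L"
      by (rule subgroup_nat_pow_closed[OF sL])
    hence "l \<otimes> (x [^] p) [^] (n div p) \<in> L" using l sL by (simp add: subgroup.m_closed)
    moreover have "(l \<otimes> (x [^] p) [^] (n div p)) \<otimes> x [^] (n mod p) = l \<otimes> x [^] n"
      using x Lc[OF l] by (simp add: m_assoc nat_pow_pow nat_pow_mult)
    moreover have "n mod p \<in> {..<p}" using p0 by simp
    ultimately show ?thesis unfolding U_def by (metis (mono_tags, lifting) SigmaI case_prod_conv image_eqI)
  qed
  have "subgroup U G"
  proof (rule finite_closed_imp_subgroup[OF fin])
    show "U \<subseteq> carrier G" unfolding U_def using Lc x by auto
    show "\<one> \<in> U" using U[of \<one> 0] subgroup.one_closed[OF sL] by simp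
    fix a b assume "a \<in> U" "b \<in> U"
    then obtain l i m j where a: "l \<in> L" "a = l \<otimes> x [^] (i::nat)" and b: "m \<in> L" "b = m \<otimes> x [^] (j::nat)"
      unfolding U_def by auto
    have c: "commutator G (x [^] i) m \<in> L" using commutator_in_frattini x Lc b gL by blast
    have "a \<otimes> b = l \<otimes> ((x [^] i) \<otimes> m) \<otimes> x [^] j"
      using a b Lc x by (simp add: m_assoc)
    also have "\<dots> = (l \<otimes> commutator G (x [^] i) m \<otimes> m) \<otimes> (x [^] i \<otimes> x [^] j)"
      using a b Lc x c commutator_mult[of "x [^] i" m, symmetric] by (simp add: m_assoc)
    also have "\<dots> = (l \<otimes> commutator G (x [^] i) m \<otimes> m) \<otimes> x [^] (i + j)"
      using x by (simp add: nat_pow_mult)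
    also have "\<dots> \<in> U" by (rule U) (use a b c sL in \<open>simp add: subgroup.m_closed\<close>)
    finally show "a \<otimes> b \<in> U" .
  qed
  moreover have "insert x S \<union> frattini p G \<subseteq> U"
  proof -
    have "L \<subseteq> U" using U[of _ 0] Lc by force
    moreover have "x \<in> U" using U[of \<one> 1] subgroup.one_closed[OF sL] x by simp
    ultimately show ?thesis using gL by blast
  qed
  ultimately have "generate G (insert x S \<union> frattini p G) \<subseteq> U" by (rule generate_subgroup_incl[rotated])
  moreover have finL: "finite L" using finite_subset[OF subgroup.subset[OF sL] fin] .
  hence "finite U" unfolding U_def by simp
  ultimately have "card (generate G (insert x S \<union> frattini p G)) \<le> card U" by (rule card_mono[rotated])
  also have "card U \<le> card (L \<times> {..<p})" unfolding U_def by (rule card_image_le) (simp add: finL)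
  also have "\<dots> = card L * p" by (simp add: card_cartesian_product)
  also have "\<dots> \<le> (p ^ card S * card (frattini p G)) * p"
    using insert unfolding L_def by (intro mult_le_mono1) auto
  finally show ?case using insert by (simp add: mult_ac)
qed

lemma frattini_index_le_min_gens:
  fixes G (structure)
  assumes p: "Factorial_Ring.prime p" and G: "finite_p_group p G"
  shows "order G \<le> p ^ min_gens G * card (frattini p G)"
proof -
  interpret group G using G by (simp add: finite_p_group_def)
  have fin: "finite (carrier G)" using G by (simp add: finite_p_group_def)
  let ?P = "\<lambda>n. \<exists>S. S \<subseteq> carrier G \<and> finite S \<and> card S = n \<and> generate G S = carrier G"
  have "?P (card (carrier G))"
    using fin generateI[OF subgroup_self, of "carrier G"] by (intro exI[of _ "carrier G"]) auto
  hence "?P (min_gens G)" unfolding min_gens_def by (rule LeastI)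
  then obtain S where S: "S \<subseteq> carrier G" "finite S" "card S = min_gens G" "generate G S = carrier G"
    by blast
  have "S \<union> frattini p G \<subseteq> carrier G" using S subgroup.subset[OF frattini_subgroup] by simp
  hence "generate G (S \<union> frattini p G) = carrier G"
    using mono_generate[of S "S \<union> frattini p G"] generate_incl[of "S \<union> frattini p G"] S by blast
  thus ?thesis using card_generate_frattini_le[OF p G S(2,1)] S by (simp add: order_def)
qed

section \<open>Commutator calculations in groups with many central elements\<close>

context group begin

lemma inv_mult_cancel_left:
  "x \<in> carrier G \<Longrightarrow> y \<in> carrier G \<Longrightarrow> inv x \<otimes> (x \<otimes> y) = y"
  by (simp add: m_assoc[symmetric])

lemma conj_nat_pow:
  assumes "g \<in> carrier G" "x \<in> carrier G"
  shows "(g \<otimes> x \<otimes> inv g) [^] (n::nat) = g \<otimes> x [^] n \<otimes> inv g"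
proof (induction n)
  case (Suc n)
  thus ?case using assms by (simp add: m_assoc inv_mult_cancel_left)
qed (use assms in simp)

lemma commutator_mult_left:
  assumes "u \<in> carrier G" "v \<in> carrier G" "g \<in> carrier G"
  shows "commutator G (u \<otimes> v) g = u \<otimes> commutator G v g \<otimes> inv u \<otimes> commutator G u g"
  using assms by (simp add: commutator_def m_assoc inv_mult_group inv_mult_cancel_left)

text \<open>
  Being central modulo \<open>B\<close> is inherited by generated subgroups.
\<close>

lemma commutator_generate_in_normal:
  assumes B: "B \<lhd> G" and S: "S \<subseteq> carrier G"
    and comm: "\<And>s g. s \<in> S \<Longrightarrow> g \<in> carrier G \<Longrightarrow> commutator G s g \<in> B"
    and u: "u \<in> generate G S" and g: "g \<in> carrier G"
  shows "commutator G u g \<in> B"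
proof -
  interpret B: normal B G by (rule B)
  show ?thesis using u g
  proof (induction arbitrary: g rule: generate.induct)
    case one
    thus ?case by (simp add: commutator_def)
  next
    case (incl s)
    thus ?case using comm by simp
  next
    case (inv s)
    have s: "s \<in> carrier G" using inv S by blast
    have "commutator G (inv s \<otimes> s) g = \<one>" using s inv by (simp add: commutator_def)
    hence "inv s \<otimes> commutator G s g \<otimes> s \<otimes> commutator G (inv s) g = \<one>"
      using commutator_mult_left[of "inv s" s g] s inv by simp
    hence "commutator G (inv s) g = inv (inv s \<otimes> commutator G s g \<otimes> s)"
      using s inv by (metis inv_equality commutator_closed inv_closed m_closed inv_comm)
    moreover have "inv s \<otimes> commutator G s g \<otimes> s \<in> B"
      using B.inv_op_closed1[OF s comm[OF inv]] .
    ultimately show ?case by simp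
  next
    case (eng u v)
    have "u \<in> carrier G" "v \<in> carrier G" using eng generate_in_carrier[OF S] by auto
    thus ?case
      using commutator_mult_left eng B.inv_op_closed2 by simp
  qed
qed

text \<open>
  The collection formula in the case where the only commutator that arises is central: moving the
  letters \<open>x\<close> past the letters \<open>w\<close> in the word \<open>(w x)\<^sup>n\<close> takes \<open>n (n - 1) / 2\<close> exchanges,
  and each costs one factor \<open>v\<close>.
\<close>

lemma expand_power_class_two:
  assumes v: "v \<in> carrier G" and w: "w \<in> carrier G" and x: "x \<in> carrier G"
    and vw: "v \<otimes> w = w \<otimes> v" and vx: "v \<otimes> x = x \<otimes> v" and xw: "x \<otimes> w = v \<otimes> w \<otimes> x"
  shows "(w \<otimes> x) [^] n = v [^] (n choose 2) \<otimes> w [^] n \<otimes> x [^] n"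
proof -
  have xnw: "x [^] n \<otimes> w = v [^] n \<otimes> w \<otimes> x [^] n" for n :: nat
  proof (induction n)
    case (Suc n)
    have "x [^] Suc n \<otimes> w = x [^] n \<otimes> v \<otimes> w \<otimes> x" using v w x xw by (simp add: m_assoc)
    also have "x [^] n \<otimes> v = v \<otimes> x [^] n" using group_commutes_pow[OF vx[symmetric] x v] by simp
    also have "v \<otimes> x [^] n \<otimes> w \<otimes> x = v \<otimes> (x [^] n \<otimes> w) \<otimes> x" using v w x by (simp add: m_assoc)
    also have "\<dots> = v \<otimes> (v [^] n \<otimes> w \<otimes> x [^] n) \<otimes> x" by (simp only: Suc)
    also have "\<dots> = (v \<otimes> v [^] n) \<otimes> w \<otimes> (x [^] n \<otimes> x)" using v w x by (simp add: m_assoc)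
    also have "v \<otimes> v [^] n = v [^] Suc n" using v by (metis nat_pow_Suc2)
    finally show ?case by simp
  qed (use w in simp)
  show ?thesis
  proof (induction n)
    case (Suc n)
    let ?t = "n choose 2"
    have "(w \<otimes> x) [^] Suc n = v [^] ?t \<otimes> w [^] n \<otimes> (x [^] n \<otimes> w) \<otimes> x"
      using Suc v w x by (simp add: m_assoc)
    also have "\<dots> = v [^] ?t \<otimes> w [^] n \<otimes> (v [^] n \<otimes> w \<otimes> x [^] n) \<otimes> x" by (simp only: xnw)
    also have "\<dots> = v [^] ?t \<otimes> (w [^] n \<otimes> v [^] n) \<otimes> w \<otimes> x [^] Suc n"
      using v w x by (simp add: m_assoc)
    also have "w [^] n \<otimes> v [^] n = v [^] n \<otimes> w [^] n"
      using v w vw by (metis group_commutes_pow nat_pow_closed)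
    also have "v [^] ?t \<otimes> (v [^] n \<otimes> w [^] n) \<otimes> w \<otimes> x [^] Suc n =
        (v [^] ?t \<otimes> v [^] n) \<otimes> w [^] Suc n \<otimes> x [^] Suc n"
      using v w x by (simp add: m_assoc)
    also have "v [^] ?t \<otimes> v [^] n = v [^] (Suc n choose 2)"
      using v by (simp add: nat_pow_mult numeral_2_eq_2 add.commute)
    finally show ?case .
  qed (simp add: numeral_2_eq_2)
qed

definition center :: "'a set" where
  "center = {z \<in> carrier G. \<forall>g\<in>carrier G. z \<otimes> g = g \<otimes> z}"

lemma center_comm: "z \<in> center \<Longrightarrow> g \<in> carrier G \<Longrightarrow> z \<otimes> g = g \<otimes> z"
  by (simp add: center_def)

lemma center_closed: "z \<in> center \<Longrightarrow> z \<in> carrier G"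
  by (simp add: center_def)

lemma center_normal: "center \<lhd> G"
proof -
  have "subgroup center G"
  proof (rule subgroupI)
    show "center \<subseteq> carrier G" by (auto simp: center_def)
    have "\<one> \<in> center" by (simp add: center_def)
    thus "center \<noteq> {}" by blast
    show "inv z \<in> center" if z: "z \<in> center" for z
    proof -
      have "inv z \<otimes> g = g \<otimes> inv z" if g: "g \<in> carrier G" for g
        using center_comm[OF z g] center_closed[OF z] g
        by (metis inv_closed inv_solve_left inv_solve_right m_closed m_assoc)
      thus ?thesis using center_closed[OF z] by (simp add: center_def)
    qed
    show "y \<otimes> z \<in> center" if y: "y \<in> center" and z: "z \<in> center" for y z
    proof -
      have "y \<otimes> z \<otimes> g = g \<otimes> (y \<otimes> z)" if g: "g \<in> carrier G" for g
        using center_comm[OF z g] center_comm[OF y g] center_closed[OF z] center_closed[OF y] g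
        by (metis m_assoc)
      thus ?thesis using center_closed[OF z] center_closed[OF y] by (simp add: center_def)
    qed
  qed
  moreover have "x \<otimes> z \<otimes> inv x = z" if "x \<in> carrier G" "z \<in> center" for x z
    using that center_comm[of z x] center_closed[of z] by (metis inv_solve_right m_closed)
  ultimately show ?thesis unfolding normal_inv_iff by auto
qed

lemma power_gens_incl: "(\<lambda>g. g [^] (n::nat)) ` carrier G \<subseteq> carrier G"
  by auto

lemma power_subgroup_is_subgroup: "subgroup (power_subgroup G n) G"
  unfolding power_subgroup_def by (rule generate_is_subgroup[OF power_gens_incl])

lemma pow_in_power_subgroup: "x \<in> carrier G \<Longrightarrow> x [^] n \<in> power_subgroup G n"
  unfolding power_subgroup_def by (rule generate.incl) auto

lemma power_subgroup_dvd:
  assumes "m dvd n"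
  shows "power_subgroup G n \<subseteq> power_subgroup G m"
  unfolding power_subgroup_def[of G n]
proof (rule generate_subgroup_incl[OF _ power_subgroup_is_subgroup], clarify)
  fix x assume x: "x \<in> carrier G"
  obtain k where "n = k * m" using assms by (metis dvd_def mult.commute)
  hence "x [^] n = (x [^] k) [^] m" using x by (simp add: nat_pow_pow)
  thus "x [^] n \<in> power_subgroup G m" using x pow_in_power_subgroup by simp
qed

text \<open>
  The quotient situation for odd \<open>p\<close>. If \<open>g\<close> conjugates \<open>x\<close> to \<open>w x\<close>, then it conjugates
  \<open>x\<^sup>p\<close> to \<open>(w x)\<^sup>p\<close>. As a commutator, \<open>w\<close> lies in the subgroup of \<open>p\<close>-th powers, so its
  commutators are central and the collection formula applies. All correction terms vanish because
  that subgroup has exponent \<open>p\<close> and \<open>p\<close> divides \<open>p (p - 1) / 2\<close>.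
\<close>

lemma commutator_pow_trivial_odd:
  assumes p: "Factorial_Ring.prime p" "p \<noteq> 2"
    and pw: "\<And>x y. x \<in> carrier G \<Longrightarrow> y \<in> carrier G \<Longrightarrow> commutator G x y \<in> power_subgroup G p"
    and ex: "\<And>u. u \<in> power_subgroup G p \<Longrightarrow> u [^] p = \<one>"
    and cen: "\<And>x g. x \<in> carrier G \<Longrightarrow> g \<in> carrier G \<Longrightarrow> commutator G (x [^] p) g \<in> center"
    and x: "x \<in> carrier G" and g: "g \<in> carrier G"
  shows "commutator G (x [^] p) g = \<one>"
proof -
  define w where "w = commutator G g x"
  define v where "v = commutator G x w"
  have w: "w \<in> power_subgroup G p" "w \<in> carrier G" unfolding w_def using pw x g by auto
  have "commutator G w x \<in> center"
    by (rule commutator_generate_in_normal[OF center_normal power_gens_incl[of p]])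
      (use cen x w in \<open>auto simp: power_subgroup_def\<close>)
  moreover have "v = inv (commutator G w x)" unfolding v_def using commutator_inv x w by simp
  ultimately have vZ: "v \<in> center"
    using subgroup.m_inv_closed[OF normal_imp_subgroup[OF center_normal]] by simp
  have v: "v \<in> power_subgroup G p" "v \<in> carrier G" unfolding v_def using pw x w by auto
  have "g \<otimes> x [^] p \<otimes> inv g = (w \<otimes> x) [^] p"
    using conj_nat_pow[OF g x, of p] commutator_conj[OF g x] by (simp add: w_def)
  also have "\<dots> = v [^] (p choose 2) \<otimes> w [^] p \<otimes> x [^] p"
  proof (rule expand_power_class_two[OF v(2) w(2) x])
    show "v \<otimes> w = w \<otimes> v" "v \<otimes> x = x \<otimes> v" using center_comm vZ w x by auto
    show "x \<otimes> w = v \<otimes> w \<otimes> x" unfolding v_def using commutator_mult x w by simp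
  qed
  also have "v [^] (p choose 2) = \<one>"
  proof -
    have "p > 2" using p prime_ge_2_nat[of p] by simp
    hence "p dvd (p choose 2)" using p by (intro dvd_choose_prime) auto
    then obtain k where "p choose 2 = p * k" by (auto simp: dvd_def)
    thus ?thesis using ex[OF v(1)] v(2) by (metis nat_pow_pow nat_pow_one)
  qed
  also have "w [^] p = \<one>" using ex w by simp
  finally have "g \<otimes> x [^] p \<otimes> inv g = x [^] p" using x by simp
  hence "x [^] p \<otimes> g = g \<otimes> x [^] p" using g x by (metis inv_closed inv_solve_right m_closed nat_pow_closed)
  thus ?thesis using commutator_eq_one_iff g x by simp
qed

text \<open>
  Here \<open>g\<close> conjugates \<open>a\<close> to \<open>w a\<close> with \<open>w\<close> central of order at most two, so it fixes
  \<open>a\<^sup>2\<close>.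
\<close>

lemma square_commutes_if_commutator_central_involution:
  assumes a: "a \<in> carrier G" and g: "g \<in> carrier G"
    and cen: "commutator G a g \<in> center" and sq: "commutator G a g [^] (2::nat) = \<one>"
  shows "a [^] (2::nat) \<otimes> g = g \<otimes> a [^] (2::nat)"
proof -
  define w where "w = commutator G g a"
  have w_inv: "w = inv (commutator G a g)" unfolding w_def using commutator_inv a g by simp
  have wZ: "w \<in> center"
    unfolding w_inv using cen subgroup.m_inv_closed[OF normal_imp_subgroup[OF center_normal]] by simp
  have w: "w \<in> carrier G" using wZ by (rule center_closed)
  have "w [^] (2::nat) = \<one>" unfolding w_inv using sq a g by (simp add: nat_pow_inv)
  hence "(w \<otimes> a) [^] (2::nat) = a [^] (2::nat)"
    using pow_mult_distrib[OF center_comm[OF wZ a] w a, of 2] a by simp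
  hence "g \<otimes> a [^] (2::nat) \<otimes> inv g = a [^] (2::nat)"
    using conj_nat_pow[OF g a, of 2] commutator_conj[OF g a] by (simp add: w_def)
  thus ?thesis using g a by (metis inv_closed inv_solve_right m_closed nat_pow_closed)
qed

text \<open>
  The quotient situation for \<open>p = 2\<close>, where \<open>p (p - 1) / 2\<close> is odd and another argument is needed.
  The previous lemma is applied twice. For \<open>a = x\<^sup>2\<close> it shows that fourth powers are central.
  Hence the subgroup that they generate, and with it every commutator, consists of central elements of
  order at most two, so that the lemma becomes applicable to \<open>a = x\<close>.
\<close>

lemma commutator_square_trivial:
  assumes pw: "\<And>x y. x \<in> carrier G \<Longrightarrow> y \<in> carrier G \<Longrightarrow> commutator G x y \<in> power_subgroup G 4"
    and ex: "\<And>u. u \<in> power_subgroup G 2 \<Longrightarrow> u [^] (4::nat) = \<one>"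
    and cen: "\<And>x g. x \<in> carrier G \<Longrightarrow> g \<in> carrier G \<Longrightarrow> commutator G (x [^] (2::nat)) g \<in> center"
    and sq: "\<And>x g. x \<in> carrier G \<Longrightarrow> g \<in> carrier G \<Longrightarrow>
      commutator G (x [^] (2::nat)) g [^] (2::nat) = \<one>"
    and x: "x \<in> carrier G" and g: "g \<in> carrier G"
  shows "commutator G (x [^] (2::nat)) g = \<one>"
proof -
  \<comment> \<open>It is enough to show that this subgroup contains all fourth powers.\<close>
  define Z2 where "Z2 = {z \<in> center. z [^] (2::nat) = \<one>}"
  interpret Z: subgroup center G by (rule normal_imp_subgroup[OF center_normal])
  have "subgroup Z2 G"
  proof (rule subgroupI)
    show "Z2 \<subseteq> carrier G" by (auto simp: Z2_def)
    have "\<one> \<in> Z2" by (simp add: Z2_def)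
    thus "Z2 \<noteq> {}" by blast
    show "inv z \<in> Z2" if "z \<in> Z2" for z
      using that by (simp add: Z2_def nat_pow_inv)
    show "y \<otimes> z \<in> Z2" if "y \<in> Z2" "z \<in> Z2" for y z
      using that pow_mult_distrib[of y z 2] center_comm[of y z] by (simp add: Z2_def)
  qed
  moreover have "(\<lambda>y. y [^] (4::nat)) ` carrier G \<subseteq> Z2"
  proof clarify
    fix y assume y: "y \<in> carrier G"
    have y4: "y [^] (4::nat) = (y [^] (2::nat)) [^] (2::nat)" using y by (simp add: nat_pow_pow)
    have "y [^] (4::nat) \<otimes> h = h \<otimes> y [^] (4::nat)" if h: "h \<in> carrier G" for h
      unfolding y4 using square_commutes_if_commutator_central_involution[OF _ h cen[OF y h] sq[OF y h]] y by simp
    moreover have "(y [^] (4::nat)) [^] (2::nat) = (y [^] (2::nat)) [^] (4::nat)"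
      using y by (simp add: nat_pow_pow)
    hence "(y [^] (4::nat)) [^] (2::nat) = \<one>" using ex[OF pow_in_power_subgroup[OF y]] by simp
    ultimately show "y [^] (4::nat) \<in> Z2"
      unfolding Z2_def center_def using y by blast
  qed
  ultimately have "power_subgroup G 4 \<subseteq> Z2"
    unfolding power_subgroup_def by (rule generate_subgroup_incl[rotated])
  hence "commutator G x g \<in> Z2" using pw[OF x g] by blast
  hence "x [^] (2::nat) \<otimes> g = g \<otimes> x [^] (2::nat)"
    using square_commutes_if_commutator_central_involution[OF x g] by (simp add: Z2_def)
  thus ?thesis using commutator_eq_one_iff g x by simp
qed

end

section \<open>Powerful groups and their subgroup of p-th powers\<close>

abbreviation powerful_exponent :: "nat \<Rightarrow> nat" where
  "powerful_exponent p \<equiv> (if p = 2 then 4 else p)"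

context group begin

lemma power_subgroup_normal: "power_subgroup G n \<lhd> G"
  unfolding power_subgroup_def
proof (rule normal_generateI[OF power_gens_incl])
  fix h g assume "h \<in> (\<lambda>g. g [^] n) ` carrier G" and g: "g \<in> carrier G"
  then obtain x where x: "x \<in> carrier G" "h = x [^] n" by blast
  thus "g \<otimes> h \<otimes> inv g \<in> (\<lambda>g. g [^] n) ` carrier G"
    using conj_nat_pow[OF g x(1), of n] g by (intro image_eqI[of _ _ "g \<otimes> x \<otimes> inv g"]) auto
qed

lemma power_subgroup_restrict:
  assumes "subgroup P G"
  shows "power_subgroup (G\<lparr>carrier := P\<rparr>) n = generate G ((\<lambda>g. g [^] n) ` P)"
proof -
  have "(\<lambda>g. g [^] n) ` P \<subseteq> P" using subgroup_nat_pow_closed[OF assms] by blast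
  thus ?thesis
    using generate_consistent[OF _ assms] by (simp add: power_subgroup_def nat_pow_consistent[symmetric])
qed

lemma power_subgroup_of_normal:
  assumes P: "P \<lhd> G"
  shows "power_subgroup (G\<lparr>carrier := P\<rparr>) n \<lhd> G"
proof -
  interpret P: normal P G by (rule P)
  show ?thesis unfolding power_subgroup_restrict[OF P.subgroup_axioms]
  proof (rule normal_generateI)
    show "(\<lambda>g. g [^] n) ` P \<subseteq> carrier G" by auto
    fix h g assume "h \<in> (\<lambda>g. g [^] n) ` P" and g: "g \<in> carrier G"
    then obtain x where x: "x \<in> P" "h = x [^] n" by blast
    thus "g \<otimes> h \<otimes> inv g \<in> (\<lambda>g. g [^] n) ` P"
      using conj_nat_pow[OF g P.mem_carrier[OF x(1)], of n] P.inv_op_closed2[OF g x(1)]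
      by (intro image_eqI[of _ _ "g \<otimes> x \<otimes> inv g"]) auto
  qed
qed

lemma pow_in_power_subgroup_of:
  assumes "subgroup P G" "x \<in> P"
  shows "x [^] n \<in> power_subgroup (G\<lparr>carrier := P\<rparr>) n"
  unfolding power_subgroup_restrict[OF assms(1)] by (rule generate.incl) (use assms in auto)

lemma power_subgroup_of_subset:
  assumes "subgroup P G"
  shows "power_subgroup (G\<lparr>carrier := P\<rparr>) n \<subseteq> P"
  unfolding power_subgroup_restrict[OF assms]
  by (rule generate_subgroup_incl[OF _ assms]) (use subgroup_nat_pow_closed[OF assms] in blast)

lemma frattini_restrict:
  assumes "subgroup K G"
  shows "frattini p (G\<lparr>carrier := K\<rparr>) = generate G ((\<lambda>x. x [^] p) ` K \<union> derived_set G K)"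
proof -
  have "(\<lambda>x. x [^] p) ` K \<union> derived_set G K \<subseteq> K"
    using subgroup_nat_pow_closed[OF assms] derived_set_incl[OF order_refl assms] by blast
  thus ?thesis
    using generate_consistent[OF _ assms] derived_set_consistent[OF order_refl assms]
    by (simp add: frattini_def nat_pow_consistent[symmetric])
qed

lemma frattini_mono:
  assumes "subgroup K G" "subgroup H G" "K \<subseteq> H"
  shows "frattini p (G\<lparr>carrier := K\<rparr>) \<subseteq> frattini p (G\<lparr>carrier := H\<rparr>)"
  unfolding frattini_restrict[OF assms(1)] frattini_restrict[OF assms(2)]
  by (rule mono_generate) (use assms(3) mono_derived_set[OF assms(3)] in blast)

end

lemma (in group_hom) power_subgroup_img:
  assumes "h ` carrier G = carrier H"
  shows "power_subgroup H n = h ` power_subgroup G n"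
proof -
  have "(\<lambda>g. g [^]\<^bsub>H\<^esub> n) ` carrier H = h ` ((\<lambda>g. g [^] n) ` carrier G)"
    unfolding assms[symmetric] image_image using hom_nat_pow by (intro image_cong) auto
  thus ?thesis unfolding power_subgroup_def using generate_img[OF G.power_gens_incl, of n] by simp
qed

lemma powerful_commutator_in:
  fixes G (structure)
  assumes "powerful_p_group p G" "x \<in> carrier G" "y \<in> carrier G"
  shows "commutator G x y \<in> power_subgroup G (powerful_exponent p)"
proof -
  have "commutator G x y \<in> derived G (carrier G)"
    unfolding derived_def by (rule generate.incl) (use assms in \<open>auto simp: commutator_def\<close>)
  thus ?thesis using assms(1) by (auto simp: powerful_p_group_def)
qed

lemma powerful_exponent_dvd: "p dvd powerful_exponent p"
  by auto

lemma powerful_frattini_eq: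
  fixes G (structure)
  assumes "powerful_p_group p G"
  shows "frattini p G = power_subgroup G p"
proof
  interpret group G using assms by (simp add: powerful_p_group_def finite_p_group_def)
  have "commutator G x y \<in> power_subgroup G p" if "x \<in> carrier G" "y \<in> carrier G" for x y
    using powerful_commutator_in[OF assms that] power_subgroup_dvd[OF powerful_exponent_dvd] by blast
  thus "frattini p G \<subseteq> power_subgroup G p"
    unfolding frattini_def derived_set_eq
    by (intro generate_subgroup_incl[OF _ power_subgroup_is_subgroup]) (auto intro: pow_in_power_subgroup)
  show "power_subgroup G p \<subseteq> frattini p G"
    unfolding frattini_def power_subgroup_def by (rule mono_generate) simp
qed

text \<open>
  The main step towards showing that \<open>P = G\<^sup>p\<close> is again powerful. If the claim fails, one passes
  to a quotient \<open>G / J\<close> in which \<open>P\<close> has exponent \<open>p\<close> (or \<open>4\<close>), all commutators \<open>[x\<^sup>p, g]\<close> are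
  central of exponent \<open>p\<close>, and not all of them are trivial. The calculations of the previous section
  show that this is impossible.
\<close>

lemma powerful_commutator_pow_in:
  fixes G (structure)
  assumes p: "Factorial_Ring.prime p" and G: "powerful_p_group p G"
    and "x \<in> carrier G" "g \<in> carrier G"
  shows "commutator G (x [^] p) g \<in>
    power_subgroup (G\<lparr>carrier := power_subgroup G p\<rparr>) (powerful_exponent p)"
proof -
  interpret group G using G by (simp add: powerful_p_group_def finite_p_group_def)
  define P where "P = power_subgroup G p"
  define B where "B = power_subgroup (G\<lparr>carrier := P\<rparr>) (powerful_exponent p)"
  define T where "T = {commutator G (x [^] p) g | x g. x \<in> carrier G \<and> g \<in> carrier G}"
  have PN: "P \<lhd> G" unfolding P_def by (rule power_subgroup_normal)
  have BN: "B \<lhd> G" unfolding B_def by (rule power_subgroup_of_normal[OF PN])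
  have Tc: "T \<subseteq> carrier G" by (auto simp: T_def)
  have "T \<subseteq> B"
  proof (rule ccontr)
    assume "\<not> T \<subseteq> B"
    with p_group_chief_step[OF p _ BN Tc] G
    obtain J where JN: "J \<lhd> G" and BJ: "B \<subseteq> J" and TJ: "\<not> T \<subseteq> J"
      and Tp: "\<forall>t\<in>T. t [^] p \<in> J" and TG: "\<forall>t\<in>T. \<forall>g\<in>carrier G. commutator G t g \<in> J"
      unfolding powerful_p_group_def by metis
    interpret J: normal J G by (rule JN)
    interpret \<pi>: group_hom G "G Mod J" "(#>) J" by (rule J.group_hom_rcos)
    have surj: "(#>) J ` carrier G = carrier (G Mod J)" by (rule carrier_FactGroup[symmetric])
    have one: "J #> x = \<one>\<^bsub>G Mod J\<^esub> \<longleftrightarrow> x \<in> J" if "x \<in> carrier G" for x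
      using that J.rcos_eq_iff by simp
    have pw: "commutator (G Mod J) V W \<in> power_subgroup (G Mod J) (powerful_exponent p)"
      if VW: "V \<in> carrier (G Mod J)" "W \<in> carrier (G Mod J)" for V W
    proof -
      obtain x y where xy: "x \<in> carrier G" "y \<in> carrier G" "V = J #> x" "W = J #> y"
        using VW unfolding surj[symmetric] by blast
      hence "commutator (G Mod J) V W = J #> commutator G x y" using \<pi>.hom_commutator by simp
      thus ?thesis
        using powerful_commutator_in[OF G xy(1,2)] \<pi>.power_subgroup_img[OF surj] by blast
    qed
    have ex: "U [^]\<^bsub>G Mod J\<^esub> powerful_exponent p = \<one>\<^bsub>G Mod J\<^esub>" if U: "U \<in> power_subgroup (G Mod J) p" for U
    proof -
      obtain u where u: "u \<in> P" "U = J #> u"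
        using U \<pi>.power_subgroup_img[OF surj] unfolding P_def by blast
      have uc: "u \<in> carrier G" using u(1) normal_imp_subgroup[OF PN] subgroup.mem_carrier by metis
      have "u [^] powerful_exponent p \<in> J"
        using pow_in_power_subgroup_of[OF normal_imp_subgroup[OF PN] u(1)] BJ unfolding B_def by blast
      hence "J #> (u [^] powerful_exponent p) = \<one>\<^bsub>G Mod J\<^esub>" using one uc by blast
      thus ?thesis unfolding u(2) using \<pi>.hom_nat_pow[OF uc] by simp
    qed
    have rep: "\<exists>t\<in>T. commutator (G Mod J) (V [^]\<^bsub>G Mod J\<^esub> p) W = J #> t"
      if VW: "V \<in> carrier (G Mod J)" "W \<in> carrier (G Mod J)" for V W
    proof -
      obtain x y where xy: "x \<in> carrier G" "y \<in> carrier G" "V = J #> x" "W = J #> y"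
        using VW unfolding surj[symmetric] by blast
      hence "commutator (G Mod J) (V [^]\<^bsub>G Mod J\<^esub> p) W = J #> commutator G (x [^] p) y"
        using \<pi>.hom_commutator[of "x [^] p" y] \<pi>.hom_nat_pow[of x p] by simp
      thus ?thesis unfolding T_def using xy by blast
    qed
    have cenT: "J #> t \<in> \<pi>.H.center" if t: "t \<in> T" for t
    proof -
      have tc: "t \<in> carrier G" using Tc t by blast
      have "(J #> t) \<otimes>\<^bsub>G Mod J\<^esub> W = W \<otimes>\<^bsub>G Mod J\<^esub> (J #> t)" if W: "W \<in> carrier (G Mod J)" for W
      proof -
        obtain y where y: "y \<in> carrier G" "W = J #> y" using W unfolding surj[symmetric] by blast
        have "commutator (G Mod J) (J #> t) W = J #> commutator G t y"
          using \<pi>.hom_commutator[OF tc y(1)] y(2) by simp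
        also have "\<dots> = \<one>\<^bsub>G Mod J\<^esub>" using TG t y(1) tc one by blast
        finally show ?thesis using \<pi>.H.commutator_eq_one_iff[OF \<pi>.hom_closed[OF tc] W] by blast
      qed
      thus ?thesis unfolding \<pi>.H.center_def using \<pi>.hom_closed[OF tc] by blast
    qed
    have cen: "commutator (G Mod J) (V [^]\<^bsub>G Mod J\<^esub> p) W \<in> \<pi>.H.center"
      if "V \<in> carrier (G Mod J)" "W \<in> carrier (G Mod J)" for V W
      using rep[OF that] cenT by auto
    have sq: "commutator (G Mod J) (V [^]\<^bsub>G Mod J\<^esub> p) W [^]\<^bsub>G Mod J\<^esub> p = \<one>\<^bsub>G Mod J\<^esub>"
      if VW: "V \<in> carrier (G Mod J)" "W \<in> carrier (G Mod J)" for V W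
    proof -
      obtain t where t: "t \<in> T" "commutator (G Mod J) (V [^]\<^bsub>G Mod J\<^esub> p) W = J #> t"
        using rep[OF VW] by blast
      have tc: "t \<in> carrier G" using Tc t by blast
      have "J #> (t [^] p) = \<one>\<^bsub>G Mod J\<^esub>" using one Tp t tc by blast
      thus ?thesis unfolding t(2) using \<pi>.hom_nat_pow[OF tc] by simp
    qed
    have trivial: "commutator (G Mod J) (V [^]\<^bsub>G Mod J\<^esub> p) W = \<one>\<^bsub>G Mod J\<^esub>"
      if "V \<in> carrier (G Mod J)" "W \<in> carrier (G Mod J)" for V W
    proof (cases "p = 2")
      case True
      have e: "powerful_exponent p = 4" using True by simp
      have ex4: "U [^]\<^bsub>G Mod J\<^esub> (4::nat) = \<one>\<^bsub>G Mod J\<^esub>" if "U \<in> power_subgroup (G Mod J) 2" for U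
        using ex[of U] that True by simp
      show ?thesis
        using \<pi>.H.commutator_square_trivial[OF pw[unfolded e] ex4
            cen[unfolded True] sq[unfolded True] that] True by simp
    next
      case False
      have e: "powerful_exponent p = p" using False by simp
      show ?thesis
        by (rule \<pi>.H.commutator_pow_trivial_odd[OF p False pw[unfolded e] ex[unfolded e] cen that])
    qed
    have "T \<subseteq> J"
    proof
      fix t assume t: "t \<in> T"
      then obtain x g where xg: "x \<in> carrier G" "g \<in> carrier G" "t = commutator G (x [^] p) g"
        unfolding T_def by blast
      hence "J #> t = \<one>\<^bsub>G Mod J\<^esub>"
        using trivial[of "J #> x" "J #> g"] \<pi>.hom_commutator[of "x [^] p" g] \<pi>.hom_nat_pow[of x p]
          \<pi>.hom_closed by simp
      thus "t \<in> J" using one Tc t by blast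
    qed
    thus False using TJ by blast
  qed
  thus ?thesis using assms(3,4) unfolding T_def B_def P_def by blast
qed

lemma powerful_commutator_power_subgroup_in:
  fixes G (structure)
  assumes p: "Factorial_Ring.prime p" and G: "powerful_p_group p G"
    and u: "u \<in> power_subgroup G p" and g: "g \<in> carrier G"
  shows "commutator G u g \<in>
    power_subgroup (G\<lparr>carrier := power_subgroup G p\<rparr>) (powerful_exponent p)"
proof -
  interpret group G using G by (simp add: powerful_p_group_def finite_p_group_def)
  show ?thesis
    by (rule commutator_generate_in_normal[OF power_subgroup_of_normal[OF power_subgroup_normal]
          power_gens_incl _ u[unfolded power_subgroup_def] g])
      (use powerful_commutator_pow_in[OF p G] in blast)
qed

lemma powerful_power_subgroup:
  fixes G (structure)
  assumes p: "Factorial_Ring.prime p" and G: "powerful_p_group p G"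
  shows "powerful_p_group p (G\<lparr>carrier := power_subgroup G p\<rparr>)"
proof -
  interpret group G using G by (simp add: powerful_p_group_def finite_p_group_def)
  let ?P = "power_subgroup G p"
  let ?B = "power_subgroup (G\<lparr>carrier := ?P\<rparr>) (powerful_exponent p)"
  have sP: "subgroup ?P G" by (rule power_subgroup_is_subgroup)
  have sB: "subgroup ?B G"
    by (rule normal_imp_subgroup[OF power_subgroup_of_normal[OF power_subgroup_normal]])
  have "derived_set G ?P \<subseteq> ?B"
    unfolding derived_set_eq
    using powerful_commutator_power_subgroup_in[OF p G] subgroup.mem_carrier[OF sP] by blast
  hence "derived G ?P \<subseteq> ?B" unfolding derived_def by (rule generate_subgroup_incl[OF _ sB])
  hence "derived (G\<lparr>carrier := ?P\<rparr>) ?P \<subseteq> ?B" using derived_consistent[OF order_refl sP] by simp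
  thus ?thesis
    using finite_p_group_subgroup[OF p _ sP] G by (simp add: powerful_p_group_def)
qed

text \<open>
  Modulo \<open>R = P\<^sup>p\<close>, where \<open>P = G\<^sup>p\<close>, commutators are central, as they lie in \<open>P\<close> and
  \<open>[P, G] \<subseteq> R\<close>. So the collection formula gives \<open>(x y)\<^sup>p = x\<^sup>p y\<^sup>p\<close> up to the factor
  \<open>c\<^bsup>p (p - 1) / 2\<^esup>\<close> with a commutator \<open>c\<close>. This factor lies in \<open>R\<close>: for odd \<open>p\<close> it is a power
  of \<open>c\<^sup>p\<close>, and for \<open>p = 2\<close> it is \<open>c\<close> itself, a product of fourth powers, which are squares
  of squares.
\<close>

lemma powerful_pth_power_hom:
  fixes G (structure)
  assumes p: "Factorial_Ring.prime p" and G: "powerful_p_group p G"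
  defines "R \<equiv> power_subgroup (G\<lparr>carrier := power_subgroup G p\<rparr>) p"
  shows "(\<lambda>x. R #> (x [^] p)) \<in> hom G (G Mod R)"
proof -
  interpret group G using G by (simp add: powerful_p_group_def finite_p_group_def)
  define P where "P = power_subgroup G p"
  have sP: "subgroup P G" unfolding P_def by (rule power_subgroup_is_subgroup)
  have RN: "R \<lhd> G" unfolding R_def by (rule power_subgroup_of_normal[OF power_subgroup_normal])
  have PG: "commutator G u g \<in> R" if u: "u \<in> P" and g: "g \<in> carrier G" for u g
    using powerful_commutator_power_subgroup_in[OF p G u[unfolded P_def] g]
      group.power_subgroup_dvd[OF subgroup_imp_group[OF sP] powerful_exponent_dvd]
    unfolding R_def P_def by blast
  interpret R: normal R G by (rule RN)
  interpret \<pi>: group_hom G "G Mod R" "(#>) R" by (rule R.group_hom_rcos)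
  have surj: "(#>) R ` carrier G = carrier (G Mod R)" by (rule carrier_FactGroup[symmetric])
  have one: "R #> x = \<one>\<^bsub>G Mod R\<^esub> \<longleftrightarrow> x \<in> R" if "x \<in> carrier G" for x
    using that R.rcos_eq_iff by simp
  have "R #> ((x \<otimes> y) [^] p) = (R #> (x [^] p)) \<otimes>\<^bsub>G Mod R\<^esub> (R #> (y [^] p))"
    if x: "x \<in> carrier G" and y: "y \<in> carrier G" for x y
  proof -
    define c where "c = commutator G y x"
    define v where "v = R #> c"
    have cP4: "c \<in> power_subgroup G (powerful_exponent p)"
      unfolding c_def by (rule powerful_commutator_in[OF G y x])
    hence cP: "c \<in> P" using power_subgroup_dvd[OF powerful_exponent_dvd] unfolding P_def by blast
    have c: "c \<in> carrier G" unfolding c_def using x y by simp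
    have vcen: "v \<otimes>\<^bsub>G Mod R\<^esub> (R #> g) = (R #> g) \<otimes>\<^bsub>G Mod R\<^esub> v" if g: "g \<in> carrier G" for g
    proof -
      have "commutator (G Mod R) v (R #> g) = \<one>\<^bsub>G Mod R\<^esub>"
        using \<pi>.hom_commutator[OF c g] one[of "commutator G c g"] PG[OF cP g] c g
        unfolding v_def by simp
      thus ?thesis
        using \<pi>.H.commutator_eq_one_iff[of v "R #> g"] \<pi>.hom_closed c g unfolding v_def by blast
    qed
    have "(R #> y) \<otimes>\<^bsub>G Mod R\<^esub> (R #> x) = v \<otimes>\<^bsub>G Mod R\<^esub> (R #> x) \<otimes>\<^bsub>G Mod R\<^esub> (R #> y)"
      using commutator_mult[OF y x] \<pi>.hom_mult c x y unfolding v_def c_def by (metis m_closed)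
    hence "((R #> x) \<otimes>\<^bsub>G Mod R\<^esub> (R #> y)) [^]\<^bsub>G Mod R\<^esub> p = v [^]\<^bsub>G Mod R\<^esub> (p choose 2) \<otimes>\<^bsub>G Mod R\<^esub>
        (R #> x) [^]\<^bsub>G Mod R\<^esub> p \<otimes>\<^bsub>G Mod R\<^esub> (R #> y) [^]\<^bsub>G Mod R\<^esub> p"
      using \<pi>.hom_closed x y c vcen unfolding v_def
      by (intro \<pi>.H.expand_power_class_two) auto
    moreover have "v [^]\<^bsub>G Mod R\<^esub> (p choose 2) = \<one>\<^bsub>G Mod R\<^esub>"
    proof -
      have "c [^] (p choose 2) \<in> R"
      proof (cases "p = 2")
        case True
        have "power_subgroup G 4 \<subseteq> R"
          unfolding power_subgroup_def[of G 4]
        proof (rule generate_subgroup_incl[OF _ R.subgroup_axioms], clarify)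
          fix z assume z: "z \<in> carrier G"
          have "(z [^] (2::nat)) [^] (2::nat) \<in> R"
            unfolding R_def True
            by (rule pow_in_power_subgroup_of[OF power_subgroup_is_subgroup pow_in_power_subgroup[OF z]])
          thus "z [^] (4::nat) \<in> R" using z by (simp add: nat_pow_pow)
        qed
        thus ?thesis using cP4 True c by auto
      next
        case False
        hence "p > 2" using prime_ge_2_nat[OF p] by simp
        hence "p dvd (p choose 2)" using p by (intro dvd_choose_prime) auto
        then obtain k where k: "p choose 2 = p * k" by (auto simp: dvd_def)
        have "c [^] p \<in> R"
          unfolding R_def by (rule pow_in_power_subgroup_of) (use cP sP P_def in auto)
        hence "(c [^] p) [^] k \<in> R" by (rule subgroup_nat_pow_closed[OF R.subgroup_axioms])
        thus ?thesis using k c by (simp add: nat_pow_pow)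
      qed
      hence "R #> (c [^] (p choose 2)) = \<one>\<^bsub>G Mod R\<^esub>" using one c by blast
      thus ?thesis unfolding v_def using \<pi>.hom_nat_pow[OF c] by simp
    qed
    ultimately show ?thesis
      using \<pi>.hom_nat_pow[of "x \<otimes> y" p] \<pi>.hom_nat_pow[of x p] \<pi>.hom_nat_pow[of y p] x y
        \<pi>.hom_mult[of x y] \<pi>.H.l_one \<pi>.hom_closed \<pi>.H.nat_pow_closed by simp
  qed
  thus ?thesis unfolding hom_def using surj by auto
qed

section \<open>The Frattini index of a subgroup of a powerful group\<close>

lemma (in group_hom) card_subgroup_image_kernel:
  assumes A: "subgroup A G" and fin: "finite A"
  shows "card A = card (h ` A) * card {x \<in> A. h x = \<one>\<^bsub>H\<^esub>}"
proof -
  interpret A: subgroup A G by (rule A)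
  have fibre: "card {x \<in> A. h x = y} = card {x \<in> A. h x = \<one>\<^bsub>H\<^esub>}" if y: "y \<in> h ` A" for y
  proof -
    obtain a where a: "a \<in> A" "y = h a" using y by blast
    have "bij_betw (\<lambda>k. k \<otimes> a) {x \<in> A. h x = \<one>\<^bsub>H\<^esub>} {x \<in> A. h x = y}"
      by (rule bij_betwI[where g = "\<lambda>x. x \<otimes> inv a"]) (use a in \<open>auto simp: G.m_assoc\<close>)
    thus ?thesis by (simp add: bij_betw_same_card)
  qed
  have "card A = (\<Sum>y\<in>h ` A. card {x \<in> A. h x = y})"
    using sum.image_gen[OF fin, of "\<lambda>_. 1::nat" h] by simp
  also have "\<dots> = (\<Sum>y\<in>h ` A. card {x \<in> A. h x = \<one>\<^bsub>H\<^esub>})" using fibre by (intro sum.cong) auto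
  finally show ?thesis by simp
qed

text \<open>
  The inequality \<open>|H : \<Phi>(H)| \<le> |G : \<Phi>(G)|\<close> of indices, by induction on the order of \<open>G\<close>.
  Put \<open>P = G\<^sup>p\<close>, \<open>R = P\<^sup>p\<close>, \<open>K = H \<inter> P\<close>, and let \<open>N\<close> be the kernel of the homomorphism
  \<open>\<theta> : G \<rightarrow> P / R\<close> given by \<open>x \<mapsto> R x\<^sup>p\<close>, so that \<open>P \<subseteq> N\<close>. Then the following facts multiply up
  to the claim.
  \<^item> \<open>|H| = |\<theta>(H)| |H \<inter> N|\<close>.
  \<^item> \<open>|H \<inter> N| / |K| \<le> |N| / |P|\<close>, since \<open>K\<close> is the intersection of \<open>H \<inter> N\<close> with \<open>P\<close>.
  \<^item> \<open>|N| |P| \<le> |G| |R|\<close>, since \<open>\<theta>\<close> is onto \<open>P / R\<close>.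
  \<^item> \<open>|\<theta>(H)| |\<Phi>(K)| \<le> |\<Phi>(H)|\<close>, since \<open>\<Phi>(H)\<close> contains the \<open>p\<close>-th powers of elements of \<open>H\<close>
    while \<open>\<Phi>(K) \<subseteq> \<Phi>(H) \<inter> \<Phi>(P) = \<Phi>(H) \<inter> R\<close>.
  \<^item> \<open>|K| |R| \<le> |\<Phi>(K)| |P|\<close>, the induction hypothesis for the powerful group \<open>P\<close>.
\<close>

lemma powerful_subgroup_frattini_index:
  fixes G (structure)
  assumes p: "Factorial_Ring.prime p" and "powerful_p_group p G" "subgroup H G"
  shows "card H * card (power_subgroup G p) \<le> card (frattini p (G\<lparr>carrier := H\<rparr>)) * order G"
  using assms(2,3)
proof (induction "order G" arbitrary: G H rule: less_induct)
  case less
  note G = less.prems(1) and H = less.prems(2)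
  interpret G: group G using G by (simp add: powerful_p_group_def finite_p_group_def)
  interpret H: subgroup H G by (rule H)
  have pG: "finite_p_group p G" using G by (simp add: powerful_p_group_def)
  have fin: "finite (carrier G)" using pG by (simp add: finite_p_group_def)
  define P where "P = power_subgroup G p"
  define FH where "FH = frattini p (G\<lparr>carrier := H\<rparr>)"
  have PN: "P \<lhd> G" unfolding P_def by (rule G.power_subgroup_normal)
  interpret P: normal P G by (rule PN)
  have sFH: "subgroup FH G"
    unfolding FH_def
    by (rule G.incl_subgroup[OF H group.frattini_subgroup[OF G.subgroup_imp_group[OF H]]])
  have fin': "finite A" if "subgroup A G" for A
    using finite_subset[OF subgroup.subset[OF that] fin] .
  show ?case
  proof (cases "P = carrier G")
    case True
    \<comment> \<open>Among finite \<open>p\<close>-groups only the trivial one equals its own Frattini subgroup.\<close>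
    have "generate G ({} \<union> frattini p G) = carrier G"
      using powerful_frattini_eq[OF G] True G.generateI[OF G.subgroup_self, of "carrier G"]
      unfolding P_def by simp
    hence "generate G {} = carrier G" by (rule frattini_nongenerators[OF p pG empty_subsetI])
    hence "carrier G = {\<one>\<^bsub>G\<^esub>}" using G.generate_empty by simp
    hence "H = {\<one>\<^bsub>G\<^esub>}" using H.subset H.one_closed by blast
    moreover have "card FH > 0"
      using fin'[OF sFH] subgroup.one_closed[OF sFH] card_gt_0_iff by blast
    ultimately show ?thesis
      using True \<open>carrier G = {\<one>\<^bsub>G\<^esub>}\<close>
      unfolding P_def[symmetric] FH_def[symmetric] order_def by simp
  next
    case False
    let ?GP = "G\<lparr>carrier := P\<rparr>"
    define R where "R = power_subgroup ?GP p"
    define K where "K = H \<inter> P"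
    define FK where "FK = frattini p (G\<lparr>carrier := K\<rparr>)"
    have GP: "powerful_p_group p ?GP" unfolding P_def by (rule powerful_power_subgroup[OF p G])
    have RN: "R \<lhd> G" unfolding R_def by (rule G.power_subgroup_of_normal[OF PN])
    have sR: "subgroup R G" by (rule normal_imp_subgroup[OF RN])
    have RP: "R \<subseteq> P" unfolding R_def by (rule G.power_subgroup_of_subset[OF P.subgroup_axioms])
    have sK: "subgroup K G" unfolding K_def by (rule G.subgroups_Inter_pair[OF H P.subgroup_axioms])
    have "order ?GP < order G"
      unfolding order_def using False P.subset fin by (simp add: psubset_card_mono psubsetI)
    moreover have "subgroup K ?GP"
      by (rule G.subgroup_incl[OF sK P.subgroup_axioms]) (simp add: K_def)
    ultimately have IH: "card K * card R \<le> card FK * card P"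
      using less.hyps[OF _ GP] unfolding R_def FK_def by (simp add: order_def)
    have FKR: "FK \<subseteq> R"
    proof -
      have "FK \<subseteq> frattini p ?GP"
        unfolding FK_def by (rule G.frattini_mono[OF sK P.subgroup_axioms]) (simp add: K_def)
      thus ?thesis using powerful_frattini_eq[OF GP] unfolding R_def by simp
    qed
    have FKH: "FK \<subseteq> FH"
      unfolding FK_def FH_def by (rule G.frattini_mono[OF sK H]) (simp add: K_def)
    define \<theta> where "\<theta> = (\<lambda>x. R #>\<^bsub>G\<^esub> (x [^]\<^bsub>G\<^esub> p))"
    interpret R: normal R G by (rule RN)
    interpret \<pi>: group_hom G "G Mod R" "(#>\<^bsub>G\<^esub>) R" by (rule R.group_hom_rcos)
    interpret \<rho>: group_hom G "G Mod P" "(#>\<^bsub>G\<^esub>) P" by (rule P.group_hom_rcos)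
    interpret \<theta>: group_hom G "G Mod R" \<theta>
      using powerful_pth_power_hom[OF p G, folded P_def, folded R_def] R.factorgroup_is_group
      by (simp add: group_hom_def group_hom_axioms_def \<theta>_def)
    have one_R: "R #>\<^bsub>G\<^esub> x = \<one>\<^bsub>G Mod R\<^esub> \<longleftrightarrow> x \<in> R" if "x \<in> carrier G" for x
      using that R.rcos_eq_iff by simp
    have one_P: "P #>\<^bsub>G\<^esub> x = \<one>\<^bsub>G Mod P\<^esub> \<longleftrightarrow> x \<in> P" if "x \<in> carrier G" for x
      using that P.rcos_eq_iff by simp
    define N where "N = {x \<in> carrier G. \<theta> x = \<one>\<^bsub>G Mod R\<^esub>}"
    define HN where "HN = {x \<in> H. \<theta> x = \<one>\<^bsub>G Mod R\<^esub>}"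
    have sN: "subgroup N G"
      using \<theta>.subgroup_kernel unfolding N_def kernel_def .
    have "HN = H \<inter> N" unfolding HN_def N_def using H.subset by auto
    hence sHN: "subgroup HN G" using G.subgroups_Inter_pair[OF H sN] by simp
    have PsubN: "P \<subseteq> N"
    proof
      fix x assume x: "x \<in> P"
      hence "x [^]\<^bsub>G\<^esub> p \<in> R"
        unfolding R_def by (rule G.pow_in_power_subgroup_of[OF P.subgroup_axioms])
      thus "x \<in> N" unfolding N_def \<theta>_def using x one_R by simp
    qed
    have cH: "card H = card (\<theta> ` H) * card HN"
      unfolding HN_def by (rule \<theta>.card_subgroup_image_kernel[OF H fin'[OF H]])
    have cHN: "card HN * card P \<le> card N * card K"
    proof -
      have "{x \<in> HN. P #>\<^bsub>G\<^esub> x = \<one>\<^bsub>G Mod P\<^esub>} = K"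
        using one_P H.mem_carrier PsubN unfolding HN_def K_def N_def by blast
      hence 1: "card HN = card ((#>\<^bsub>G\<^esub>) P ` HN) * card K"
        using \<rho>.card_subgroup_image_kernel[OF sHN fin'[OF sHN]] by simp
      have "{x \<in> N. P #>\<^bsub>G\<^esub> x = \<one>\<^bsub>G Mod P\<^esub>} = P"
        using one_P PsubN unfolding N_def by blast
      hence 2: "card N = card ((#>\<^bsub>G\<^esub>) P ` N) * card P"
        using \<rho>.card_subgroup_image_kernel[OF sN fin'[OF sN]] by simp
      have "HN \<subseteq> N" unfolding HN_def N_def using H.subset by auto
      hence "card ((#>\<^bsub>G\<^esub>) P ` HN) \<le> card ((#>\<^bsub>G\<^esub>) P ` N)"
        using fin'[OF sN] by (intro card_mono image_mono) auto
      thus ?thesis unfolding 1 2 by (simp add: mult_ac)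
    qed
    have cN: "card N * card P \<le> order G * card R"
    proof -
      have "(#>\<^bsub>G\<^esub>) R ` P = generate (G Mod R) ((#>\<^bsub>G\<^esub>) R ` ((\<lambda>g. g [^]\<^bsub>G\<^esub> p) ` carrier G))"
        unfolding P_def power_subgroup_def by (rule \<pi>.generate_img[OF G.power_gens_incl, symmetric])
      also have "\<dots> \<subseteq> \<theta> ` carrier G"
        by (rule \<pi>.H.generate_subgroup_incl[OF _ \<theta>.img_is_subgroup]) (auto simp: \<theta>_def)
      finally have "card ((#>\<^bsub>G\<^esub>) R ` P) \<le> card (\<theta> ` carrier G)" by (intro card_mono) (use fin in auto)
      moreover have "{x \<in> P. R #>\<^bsub>G\<^esub> x = \<one>\<^bsub>G Mod R\<^esub>} = R" using one_R RP P.mem_carrier by blast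
      hence "card P = card ((#>\<^bsub>G\<^esub>) R ` P) * card R"
        using \<pi>.card_subgroup_image_kernel[OF P.subgroup_axioms fin'[OF P.subgroup_axioms]] by simp
      ultimately have "card P \<le> card (\<theta> ` carrier G) * card R" by simp
      hence "card N * card P \<le> card N * (card (\<theta> ` carrier G) * card R)" by simp
      moreover have "order G = card (\<theta> ` carrier G) * card N"
        unfolding order_def N_def by (rule \<theta>.card_subgroup_image_kernel[OF G.subgroup_self fin])
      ultimately show ?thesis by (simp add: mult_ac)
    qed
    have cF: "card (\<theta> ` H) * card FK \<le> card FH"
    proof -
      have "\<theta> ` H \<subseteq> (#>\<^bsub>G\<^esub>) R ` FH"
      proof
        fix y assume "y \<in> \<theta> ` H"
        then obtain x where x: "x \<in> H" "y = \<theta> x" by blast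
        have "x [^]\<^bsub>G\<^esub> p \<in> FH"
          unfolding FH_def G.frattini_restrict[OF H] by (rule generate.incl) (use x in auto)
        thus "y \<in> (#>\<^bsub>G\<^esub>) R ` FH" unfolding x(2) \<theta>_def by blast
      qed
      hence "card (\<theta> ` H) \<le> card ((#>\<^bsub>G\<^esub>) R ` FH)" using fin'[OF sFH] by (intro card_mono) auto
      moreover have "FK \<subseteq> {x \<in> FH. R #>\<^bsub>G\<^esub> x = \<one>\<^bsub>G Mod R\<^esub>}"
        using FKR FKH one_R R.mem_carrier by blast
      hence "card FK \<le> card {x \<in> FH. R #>\<^bsub>G\<^esub> x = \<one>\<^bsub>G Mod R\<^esub>}"
        using fin'[OF sFH] by (intro card_mono) auto
      ultimately show ?thesis
        using \<pi>.card_subgroup_image_kernel[OF sFH fin'[OF sFH]] by (simp add: mult_le_mono)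
    qed
    have "card H * card P * card R = card (\<theta> ` H) * (card HN * card P) * card R"
      using cH by simp
    also have "\<dots> \<le> card (\<theta> ` H) * (card N * card K) * card R"
      by (intro mult_le_mono cHN order_refl)
    also have "\<dots> = card (\<theta> ` H) * card N * (card K * card R)" by (simp add: mult_ac)
    also have "\<dots> \<le> card (\<theta> ` H) * card N * (card FK * card P)"
      by (intro mult_le_mono IH order_refl)
    also have "\<dots> = (card (\<theta> ` H) * card FK) * (card N * card P)" by (simp add: mult_ac)
    also have "\<dots> \<le> card FH * (order G * card R)" by (intro mult_le_mono cF cN)
    finally have "card H * card P * card R \<le> card FH * order G * card R" by (simp add: mult_ac)
    moreover have "card R > 0" using fin'[OF sR] subgroup.one_closed[OF sR] card_gt_0_iff by blast
    ultimately show ?thesis unfolding P_def[symmetric] FH_def[symmetric] by simp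
  qed
qed

theorem corollary5p4:
  fixes p :: nat and G :: "('a, 'b) monoid_scheme" and H :: "'a set"
  assumes "Factorial_Ring.prime p"
    and "powerful_p_group p G"
    and "subgroup H G"
  shows "min_gens (G\<lparr>carrier := H\<rparr>) \<le> min_gens G"
proof -
  note p = assms(1)
  have pG: "finite_p_group p G" using assms(2) by (simp add: powerful_p_group_def)
  interpret group G using pG by (simp add: finite_p_group_def)
  let ?H = "G\<lparr>carrier := H\<rparr>"
  have pH: "finite_p_group p ?H" by (rule finite_p_group_subgroup[OF p pG assms(3)])
  let ?dG = "min_gens G" and ?dH = "min_gens ?H"
  let ?FG = "card (frattini p G)" and ?FH = "card (frattini p ?H)"
  have pos: "card (frattini p L) > 0" if "finite_p_group p L" for L :: "('a, 'b) monoid_scheme"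
  proof -
    interpret L: group L using that by (simp add: finite_p_group_def)
    have "finite (frattini p L)"
      using that L.frattini_subgroup[of p] by (meson finite_p_group_def finite_subset subgroup.subset)
    thus ?thesis using subgroup.one_closed[OF L.frattini_subgroup[of p]] card_gt_0_iff by blast
  qed
  have "p ^ ?dH * ?FH * ?FG \<le> card H * ?FG"
    using min_gens_le_frattini_index[OF p pH] by (intro mult_le_mono1) (simp add: order_def)
  also have "\<dots> \<le> ?FH * order G"
    using powerful_subgroup_frattini_index[OF assms] powerful_frattini_eq[OF assms(2)] by simp
  also have "\<dots> \<le> ?FH * (p ^ ?dG * ?FG)"
    using frattini_index_le_min_gens[OF p pG] by (rule mult_le_mono2)
  finally have "p ^ ?dH * (?FH * ?FG) \<le> p ^ ?dG * (?FH * ?FG)" by (simp only: mult_ac)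
  hence "p ^ ?dH \<le> p ^ ?dG" using pos[OF pG] pos[OF pH] by simp
  thus ?thesis using prime_gt_1_nat[OF p] by simp
qed

end
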